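(* Let $\varphi$ be an action of a group $G$ on $\mathbb{R}^d$ by smooth diffeomorphisms, and let $(\mathcal{P}_\varphi^\bullet,d,\star)$ be its DGA of formal $G$-amplitudes. Let $P^0\in \mathbf{Pol}_d^{1}(0)$ be a Maurer–Cartan element (i.e. $dP^0+P^0\star P^0=0$) and let $P^1\in\mathbf{Pol}_d^1(1)$ be a one-cocycle, i.e. $d_{P^0}P^1=0$. If $H^2(\mathbf{Pol}_d^\bullet(n),d_{P^0})=0$ for all $n\ge 2$, then there exists a Maurer–Cartan element $\omega$ in $\mathcal{P}_\varphi^\bullet$ such that $$\omega=P^0+\hbar P^1+\mathcal{O}(\hbar^2).$$ Moreover, if $H^1(\mathbf{Pol}_d^\bullet(n),d_{P^0})=0$ for all $n\ge 1$, then the Maurer–Cartan element $P^0$ is rigid.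
   Context: An action is a family of diffeomorphisms $\varphi_g$ of $\mathbb{R}^d$, $g\in G$, with $\varphi_{gh}=\varphi_g\circ\varphi_h$ and $\varphi_e=\mathrm{id}$. $G$ is any group (no topology), and functions are complex valued. Polynomial symbols: for $n\ge0$, $\mathbf{Pol}_d(n)$ is the space of functions $P(x,\xi)=\sum_{|\alpha|\le n}f_\alpha(x)\xi^\alpha$ with $f_\alpha\in C^\infty(\mathbb{R}^d)$, where $x,\xi\in\mathbb{R}^d$ and $\alpha$ is a multi-index. $\mathcal{P}$ is the space of formal symbols $P=\sum_{n\ge0}\hbar^nP^n$ with $P^n\in\mathbf{Pol}_d(n)$. Formal operators: with $D^\alpha=i^{-|\alpha|}\partial_x^\alpha$ and $P^n(x,\xi)=\sum_{|\alpha|\le n}f_{n,\alpha}(x)\xi^\alpha$, a pair $P\in\mathcal{P}$, $\phi\in\mathrm{Diff}(\mathbb{R}^d)$ defines the $\mathbb{C}[[\hbar]]$-linear operator on $C^\infty(\mathbb{R}^d)[[\hbar]]$ $$\mathrm{Op}_1(P,\phi)\psi(x)=\sum_{n\ge0}\hbar^n\sum_{|\alpha|\le n}f_{n,\alpha}(x)\,(D^\alpha\psi)(\phi^{-1}(x)).$$ For $P,K\in\mathcal{P}$ and diffeomorphisms $\phi_1,\phi_2$, the symbol $P\,{}_{\phi_1}\star_{\phi_2}K\in\mathcal{P}$ is determined by $\mathrm{Op}_1(P,\phi_1)\circ\mathrm{Op}_1(K,\phi_2)=\mathrm{Op}_1(P\,{}_{\phi_1}\star_{\phi_2}K,\ \phi_1\circ\phi_2)$.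 DGA of formal $G$-amplitudes: $\mathcal{P}_\varphi^k$ is the space of all maps $a:G^k\to\mathcal{P}$ ($\mathcal{P}_\varphi^0=\mathcal{P}$). The differential $d:\mathcal{P}^k_\varphi\to\mathcal{P}^{k+1}_\varphi$ is $(da)_{g_1,\dots,g_{k+1}}=\sum_{i=1}^k(-1)^ia_{g_1,\dots,g_ig_{i+1},\dots,g_{k+1}}$ (zero for $k=0$). The product of $a\in\mathcal{P}_\varphi^k$ and $b\in\mathcal{P}_\varphi^l$ is $(a\star b)_{g_1,\dots,g_{k+l}}=a_{g_1,\dots,g_k}\;{}_{\varphi_{g_1\cdots g_k}}\star_{\varphi_{g_{k+1}\cdots g_{k+l}}}\;b_{g_{k+1},\dots,g_{k+l}}$ (the empty product of group elements is $e$). A Maurer–Cartan element is $a\in\mathcal{P}_\varphi^1$ with $da+a\star a=0$. Two Maurer–Cartan elements $a,b$ are gauge equivalent if there is an invertible $u\in\mathcal{P}_\varphi^0$ (invertible for $\star$) with $a\star u-u\star b=du$. A Maurer–Cartan element $P^0\in\mathbf{Pol}^1_d(0)$ is rigid if every Maurer–Cartan element of the form $P^0+\hbar Q^1+\hbar^2Q^2+\cdots$ is gauge equivalent to $P^0$. Complexes: $\mathbf{Pol}_d^k(n)$ is the space of all maps $G^k\to\mathbf{Pol}_d(n)$, so that $\mathcal{P}_\varphi^\bullet=\bigoplus_{n\ge 0}\hbar^n\mathbf{Pol}_d^\bullet(n)$ (formal power series in $\hbar$). For a Maurer–Cartan element $P^0\in\mathbf{Pol}_d^1(0)$, the twisted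 differential is $d_{P^0}a=da+P^0\star a-(-1)^{k}a\star P^0$ for $a$ of degree $k$. It preserves each summand $\hbar^n\mathbf{Pol}_d^\bullet(n)$, and so (dropping the factor $\hbar^n$) makes each $(\mathbf{Pol}_d^\bullet(n),d_{P^0})$ a cochain complex. $\mathcal{O}(\hbar^2)$ denotes an element of the form $\sum_{n\ge2}\hbar^nP^n$ with $P^n\in\mathbf{Pol}_d^1(n)$. *)

theory Defs
  imports
    "HOL-Analysis.Analysis"
    "HOL-Algebra.Elementary_Groups"
    "HOL-Library.Function_Algebras"
begin

text \<open>Addition, subtraction and zero of cochains are the pointwise operations on functions of
  \<open>HOL-Library.Function_Algebras\<close>.\<close>

primrec times_cont_diff :: "nat \<Rightarrow> ('a::real_normed_vector \<Rightarrow> 'b::real_normed_vector) \<Rightarrow> bool"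
  where
    "times_cont_diff 0 f \<longleftrightarrow> continuous_on UNIV f"
  | "times_cont_diff (Suc r) f \<longleftrightarrow>
       (\<forall>x. f differentiable (at x)) \<and>
       (\<forall>v. times_cont_diff r (\<lambda>x. frechet_derivative f (at x) v))"

definition smooth :: "('a::real_normed_vector \<Rightarrow> 'b::real_normed_vector) \<Rightarrow> bool"
  where "smooth f \<longleftrightarrow> (\<forall>r. times_cont_diff r f)"

definition diffeo :: "('a::real_normed_vector \<Rightarrow> 'a) \<Rightarrow> bool"
  where "diffeo f \<longleftrightarrow> bij f \<and> smooth f \<and> smooth (inv_into UNIV f)"

definition partial :: "'d::finite \<Rightarrow> (real^'d \<Rightarrow> complex) \<Rightarrow> real^'d \<Rightarrow> complex"
  where "partial i f = (\<lambda>x. frechet_derivative f (at x) (axis i 1))"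

type_synonym 'd multi_index = "'d \<Rightarrow> nat"

definition mi_size :: "('d::finite) multi_index \<Rightarrow> nat"
  where "mi_size \<alpha> = (\<Sum>i\<in>UNIV. \<alpha> i)"

text \<open>The index type carries no order, so an enumeration of the coordinates is chosen. On smooth
  functions the result does not depend on it, because partial derivatives commute.\<close>

definition coords :: "('d::finite) list"
  where "coords = (SOME xs. distinct xs \<and> set xs = UNIV)"

definition partials :: "('d::finite) multi_index \<Rightarrow> (real^'d \<Rightarrow> complex) \<Rightarrow> real^'d \<Rightarrow> complex"
  where "partials \<alpha> = foldr (\<lambda>i. partial i ^^ \<alpha> i) coords"

definition Dop :: "('d::finite) multi_index \<Rightarrow> (real^'d \<Rightarrow> complex) \<Rightarrow> real^'d \<Rightarrow> complex"
  where "Dop \<alpha> f = (\<lambda>x. \<i> powi (- int (mi_size \<alpha>)) * partials \<alpha> f x)"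

type_synonym 'd symbol = "real^'d \<Rightarrow> real^'d \<Rightarrow> complex"

definition monomial :: "('d::finite) multi_index \<Rightarrow> real^'d \<Rightarrow> complex"
  where "monomial \<alpha> \<xi> = (\<Prod>i\<in>UNIV. complex_of_real (\<xi> $ i) ^ \<alpha> i)"

definition symbol_of :: "nat \<Rightarrow> (('d::finite) multi_index \<Rightarrow> real^'d \<Rightarrow> complex) \<Rightarrow> 'd symbol"
  where "symbol_of n f = (\<lambda>x \<xi>. \<Sum>\<alpha> | mi_size \<alpha> \<le> n. f \<alpha> x * monomial \<alpha> \<xi>)"

definition Pol :: "nat \<Rightarrow> ('d::finite) symbol set"
  where "Pol n = {symbol_of n f | f. \<forall>\<alpha>. smooth (f \<alpha>)}"

text \<open>A polynomial function of \<open>\<xi>\<close> determines its coefficients; those with index of size greater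
  than \<open>n\<close> are normalised to zero.\<close>

definition symbol_coeff :: "nat \<Rightarrow> ('d::finite) symbol \<Rightarrow> 'd multi_index \<Rightarrow> real^'d \<Rightarrow> complex"
  where "symbol_coeff n P =
    (THE f. (\<forall>\<alpha>. smooth (f \<alpha>)) \<and> (\<forall>\<alpha>. mi_size \<alpha> > n \<longrightarrow> f \<alpha> = (\<lambda>x. 0)) \<and> P = symbol_of n f)"

text \<open>A formal power series in \<open>\<hbar>\<close> is the sequence of its coefficients.\<close>

type_synonym 'd formal_symbol = "nat \<Rightarrow> 'd symbol"
type_synonym 'd formal_function = "nat \<Rightarrow> real^'d \<Rightarrow> complex"

definition formal_symbols :: "('d::finite) formal_symbol set"
  where "formal_symbols = {P. \<forall>n. P n \<in> Pol n}"

definition formal_functions :: "('d::finite) formal_function set"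
  where "formal_functions = {\<psi>. \<forall>n. smooth (\<psi> n)}"

text \<open>The coefficient of \<open>\<hbar>^N\<close> in the \<open>\<complex>[[\<hbar>]]\<close>-linear extension collects the terms
  \<open>\<hbar>^n \<hbar>^(N - n)\<close> with \<open>n \<le> N\<close>.\<close>

definition Op1 ::
    "('d::finite) formal_symbol \<Rightarrow> (real^'d \<Rightarrow> real^'d) \<Rightarrow> 'd formal_function \<Rightarrow> 'd formal_function"
  where "Op1 P \<phi> \<psi> = (\<lambda>N x. \<Sum>n\<le>N. \<Sum>\<alpha> | mi_size \<alpha> \<le> n.
    symbol_coeff n (P n) \<alpha> x * Dop \<alpha> (\<psi> (N - n)) (inv_into UNIV \<phi> x))"

definition symbol_star ::
    "(real^'d \<Rightarrow> real^'d) \<Rightarrow> (real^'d \<Rightarrow> real^'d) \<Rightarrow>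
     ('d::finite) formal_symbol \<Rightarrow> 'd formal_symbol \<Rightarrow> 'd formal_symbol"
  where "symbol_star \<phi>1 \<phi>2 P K =
    (THE R. R \<in> formal_symbols \<and>
       (\<forall>\<psi>\<in>formal_functions. Op1 P \<phi>1 (Op1 K \<phi>2 \<psi>) = Op1 R (\<phi>1 \<circ> \<phi>2) \<psi>))"

definition smooth_action ::
    "('g, 'm) monoid_scheme \<Rightarrow> ('g \<Rightarrow> real^'d \<Rightarrow> real^('d::finite)) \<Rightarrow> bool"
  where "smooth_action G \<phi> \<longleftrightarrow>
    (\<forall>g\<in>carrier G. diffeo (\<phi> g)) \<and>
    (\<forall>g\<in>carrier G. \<forall>h\<in>carrier G. \<phi> (g \<otimes>\<^bsub>G\<^esub> h) = \<phi> g \<circ> \<phi> h) \<and>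
    \<phi> \<one>\<^bsub>G\<^esub> = id"

definition tuples :: "('g, 'm) monoid_scheme \<Rightarrow> nat \<Rightarrow> 'g list set"
  where "tuples G k = {gs. set gs \<subseteq> carrier G \<and> length gs = k}"

text \<open>A map on \<open>G^k\<close> is represented by its extension by zero to all lists, so that equality of maps
  on \<open>G^k\<close> is equality of functions.\<close>

type_synonym ('g, 'd) amplitude = "'g list \<Rightarrow> 'd formal_symbol"

definition amplitudes :: "('g, 'm) monoid_scheme \<Rightarrow> nat \<Rightarrow> ('g, 'd::finite) amplitude set"
  where "amplitudes G k =
    {a. (\<forall>gs\<in>tuples G k. a gs \<in> formal_symbols) \<and> (\<forall>gs. gs \<notin> tuples G k \<longrightarrow> a gs = 0)}"

definition Pol_cochains ::
    "('g, 'm) monoid_scheme \<Rightarrow> nat \<Rightarrow> nat \<Rightarrow> ('g list \<Rightarrow> ('d::finite) symbol) set"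
  where "Pol_cochains G n k =
    {c. (\<forall>gs\<in>tuples G k. c gs \<in> Pol n) \<and> (\<forall>gs. gs \<notin> tuples G k \<longrightarrow> c gs = 0)}"

text \<open>Tuples are indexed from 1 in the formula for the differential, lists from 0.\<close>

definition merge :: "('g, 'm) monoid_scheme \<Rightarrow> nat \<Rightarrow> 'g list \<Rightarrow> 'g list"
  where "merge G i gs = take (i - 1) gs @ [gs ! (i - 1) \<otimes>\<^bsub>G\<^esub> gs ! i] @ drop (i + 1) gs"

definition diff ::
    "('g, 'm) monoid_scheme \<Rightarrow> nat \<Rightarrow> ('g, 'd::finite) amplitude \<Rightarrow> ('g, 'd) amplitude"
  where "diff G k a = (\<lambda>gs. if gs \<in> tuples G (k + 1)
    then (\<lambda>n x \<xi>. \<Sum>i = 1..k. (-1) ^ i * a (merge G i gs) n x \<xi>) else 0)"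

definition group_prod :: "('g, 'm) monoid_scheme \<Rightarrow> 'g list \<Rightarrow> 'g"
  where "group_prod G gs = foldr (\<lambda>g h. g \<otimes>\<^bsub>G\<^esub> h) gs \<one>\<^bsub>G\<^esub>"

definition star ::
    "('g, 'm) monoid_scheme \<Rightarrow> ('g \<Rightarrow> real^'d \<Rightarrow> real^'d) \<Rightarrow> nat \<Rightarrow> nat \<Rightarrow>
     ('g, 'd::finite) amplitude \<Rightarrow> ('g, 'd) amplitude \<Rightarrow> ('g, 'd) amplitude"
  where "star G \<phi> k l a b = (\<lambda>gs. if gs \<in> tuples G (k + l)
    then symbol_star (\<phi> (group_prod G (take k gs))) (\<phi> (group_prod G (drop k gs)))
           (a (take k gs)) (b (drop k gs))
    else 0)"

text \<open>\<open>hbar_times n c\<close> is \<open>\<hbar>^n c\<close>.\<close>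

definition hbar_times :: "nat \<Rightarrow> ('g list \<Rightarrow> ('d::finite) symbol) \<Rightarrow> ('g, 'd) amplitude"
  where "hbar_times n c = (\<lambda>gs m. if m = n then c gs else 0)"

definition O_hbar :: "('g, 'm) monoid_scheme \<Rightarrow> nat \<Rightarrow> nat \<Rightarrow> ('g, 'd::finite) amplitude set"
  where "O_hbar G k m = {a \<in> amplitudes G k. \<forall>gs. \<forall>n<m. a gs n = 0}"

definition maurer_cartan ::
    "('g, 'm) monoid_scheme \<Rightarrow> ('g \<Rightarrow> real^'d \<Rightarrow> real^'d) \<Rightarrow> ('g, 'd::finite) amplitude \<Rightarrow> bool"
  where "maurer_cartan G \<phi> a \<longleftrightarrow>
    a \<in> amplitudes G 1 \<and> diff G 1 a + star G \<phi> 1 1 a a = 0"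

definition unit_amplitude :: "('g, 'd::finite) amplitude"
  where "unit_amplitude = hbar_times 0 (\<lambda>gs. if gs = [] then (\<lambda>x \<xi>. 1) else 0)"

definition invertible_amplitude ::
    "('g, 'm) monoid_scheme \<Rightarrow> ('g \<Rightarrow> real^'d \<Rightarrow> real^'d) \<Rightarrow> ('g, 'd::finite) amplitude \<Rightarrow> bool"
  where "invertible_amplitude G \<phi> u \<longleftrightarrow>
    u \<in> amplitudes G 0 \<and>
    (\<exists>v\<in>amplitudes G 0. star G \<phi> 0 0 u v = unit_amplitude \<and> star G \<phi> 0 0 v u = unit_amplitude)"

definition gauge_equivalent ::
    "('g, 'm) monoid_scheme \<Rightarrow> ('g \<Rightarrow> real^'d \<Rightarrow> real^'d) \<Rightarrow>
     ('g, 'd::finite) amplitude \<Rightarrow> ('g, 'd) amplitude \<Rightarrow> bool"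
  where "gauge_equivalent G \<phi> a b \<longleftrightarrow>
    (\<exists>u. invertible_amplitude G \<phi> u \<and> star G \<phi> 1 0 a u - star G \<phi> 0 1 u b = diff G 0 u)"

definition rigid ::
    "('g, 'm) monoid_scheme \<Rightarrow> ('g \<Rightarrow> real^'d \<Rightarrow> real^'d) \<Rightarrow>
     ('g list \<Rightarrow> ('d::finite) symbol) \<Rightarrow> bool"
  where "rigid G \<phi> P0 \<longleftrightarrow>
    P0 \<in> Pol_cochains G 0 1 \<and> maurer_cartan G \<phi> (hbar_times 0 P0) \<and>
    (\<forall>a. maurer_cartan G \<phi> a \<and> (\<exists>Q\<in>O_hbar G 1 1. a = hbar_times 0 P0 + Q) \<longrightarrow>
       gauge_equivalent G \<phi> a (hbar_times 0 P0))"

definition twisted_diff ::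
    "('g, 'm) monoid_scheme \<Rightarrow> ('g \<Rightarrow> real^'d \<Rightarrow> real^'d) \<Rightarrow> ('g list \<Rightarrow> ('d::finite) symbol) \<Rightarrow>
     nat \<Rightarrow> ('g, 'd) amplitude \<Rightarrow> ('g, 'd) amplitude"
  where "twisted_diff G \<phi> P0 k a = (\<lambda>gs n x \<xi>.
    diff G k a gs n x \<xi> + star G \<phi> 1 k (hbar_times 0 P0) a gs n x \<xi>
      - (-1) ^ k * star G \<phi> k 1 a (hbar_times 0 P0) gs n x \<xi>)"

definition Pol_diff ::
    "('g, 'm) monoid_scheme \<Rightarrow> ('g \<Rightarrow> real^'d \<Rightarrow> real^'d) \<Rightarrow> ('g list \<Rightarrow> ('d::finite) symbol) \<Rightarrow>
     nat \<Rightarrow> nat \<Rightarrow> ('g list \<Rightarrow> 'd symbol) \<Rightarrow> ('g list \<Rightarrow> 'd symbol)"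
  where "Pol_diff G \<phi> P0 n k c = (\<lambda>gs. twisted_diff G \<phi> P0 k (hbar_times n c) gs n)"

definition cocycles ::
    "('g, 'm) monoid_scheme \<Rightarrow> ('g \<Rightarrow> real^'d \<Rightarrow> real^'d) \<Rightarrow> ('g list \<Rightarrow> ('d::finite) symbol) \<Rightarrow>
     nat \<Rightarrow> nat \<Rightarrow> ('g list \<Rightarrow> 'd symbol) set"
  where "cocycles G \<phi> P0 n k = {c \<in> Pol_cochains G n k. Pol_diff G \<phi> P0 n k c = 0}"

definition coboundaries ::
    "('g, 'm) monoid_scheme \<Rightarrow> ('g \<Rightarrow> real^'d \<Rightarrow> real^'d) \<Rightarrow> ('g list \<Rightarrow> ('d::finite) symbol) \<Rightarrow>
     nat \<Rightarrow> nat \<Rightarrow> ('g list \<Rightarrow> 'd symbol) set"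
  where "coboundaries G \<phi> P0 n k =
    (case k of 0 \<Rightarrow> {0} | Suc j \<Rightarrow> Pol_diff G \<phi> P0 n j ` Pol_cochains G n j)"

definition additive_group :: "'a::ab_group_add set \<Rightarrow> 'a monoid"
  where "additive_group A = \<lparr>carrier = A, monoid.mult = (+), one = 0\<rparr>"

definition cohomology ::
    "('g, 'm) monoid_scheme \<Rightarrow> ('g \<Rightarrow> real^'d \<Rightarrow> real^'d) \<Rightarrow> ('g list \<Rightarrow> ('d::finite) symbol) \<Rightarrow>
     nat \<Rightarrow> nat \<Rightarrow> ('g list \<Rightarrow> 'd symbol) set monoid"
  where "cohomology G \<phi> P0 n k =
    additive_group (cocycles G \<phi> P0 n k) Mod coboundaries G \<phi> P0 n k"

end

theory Submission
  imports Defs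
begin

text \<open>A symbol over a diffeomorphism acts faithfully on smooth functions (test it on plane waves), so the
  star product becomes multiplication of power series over the ring of operators. There a degree-one
  amplitude is Maurer--Cartan iff its operators satisfy \<open>A g * A h = A (g h)\<close>, and an invertible \<open>u\<close> is
  a gauge transformation from \<open>A\<close> to \<open>A0\<close> iff \<open>A g * u = u * A0 g\<close>. Both equations are solved order by
  order in \<open>\<hbar>\<close>: the coefficient of \<open>\<hbar>^N\<close> of the defect of a solution modulo \<open>\<hbar>^N\<close> is a cocycle for
  the twisted differential, by associativity alone, and correcting the solution changes it by an
  arbitrary coboundary.\<close>

section \<open>Smooth functions\<close>

text \<open>\<open>symbol_star\<close> is given by a definite description and no explicit formula
  for it is used, so its existence and uniqueness carry the analytic weight. Existence: differential
  operators over smooth maps are closed under composition and their orders add, by the Leibniz and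
  chain rules and the symmetry of second derivatives. Uniqueness: an operator applied to
  \<open>plane_wave \<xi>\<close> returns the value of its symbol at \<xi>, times a nowhere
  vanishing factor. The bound n on the degree of the coefficient of \<hbar>^n ties order N of a
  deformation to the complex of \<open>Pol N\<close>: orders add, so a defect at \<hbar>^N is an
  operator of order at most N and its correction may be sought among such operators. This filtration
  is all that the algebra sees of differential operators, whence the abstract sets
  \<open>M n g\<close>. The orders 0 and 1 of a solution are prescribed, so the first obstruction
  sits in order 2; a gauge transformation starts from the constant 1, so its first obstruction sits
  in order 1. This is the origin of the two ranges of n.\<close>

lemma times_cont_diff_Suc_imp: "times_cont_diff (Suc r) f \<Longrightarrow> times_cont_diff r f"
proof (induction r arbitrary: f)
  case 0
  then show ?case
    by (auto intro!: continuous_at_imp_continuous_on differentiable_imp_continuous_within)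
next
  case (Suc r)
  then show ?case by (metis times_cont_diff.simps(2))
qed

lemma smooth_differentiable: "smooth f \<Longrightarrow> f differentiable (at x)"
  unfolding smooth_def using times_cont_diff.simps(2) by blast

lemma smooth_frechet_derivative: "smooth f \<Longrightarrow> smooth (\<lambda>x. frechet_derivative f (at x) v)"
  unfolding smooth_def using times_cont_diff.simps(2) by blast

lemma smooth_continuous: "smooth f \<Longrightarrow> continuous_on UNIV f"
  unfolding smooth_def using times_cont_diff.simps(1) by blast

lemma smooth_has_derivative: "smooth f \<Longrightarrow> (f has_derivative frechet_derivative f (at x)) (at x)"
  using smooth_differentiable frechet_derivative_works by blast

text \<open>Smoothness is the largest property of differentiable functions that is stable under
  directional derivatives. This suits classes with an evident closure, such as constants, linear
  images of smooth functions, or multiples of a plane wave.\<close>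

lemma smooth_coinduct:
  assumes "X f"
    and diff: "\<And>f x. X f \<Longrightarrow> f differentiable (at x)"
    and deriv: "\<And>f v. X f \<Longrightarrow> X (\<lambda>x. frechet_derivative f (at x) v)"
  shows "smooth f"
proof -
  have "times_cont_diff r f" if "X f" for r f
    using that
  proof (induction r arbitrary: f)
    case 0
    then show ?case using diff
      by (auto intro!: continuous_at_imp_continuous_on differentiable_imp_continuous_within)
  next
    case (Suc r)
    then show ?case using diff deriv by simp
  qed
  then show ?thesis using \<open>X f\<close> by (simp add: smooth_def)
qed

lemma smooth_const [simp]: "smooth (\<lambda>x. c)"
  by (rule smooth_coinduct[where X = "\<lambda>f. \<exists>c. f = (\<lambda>x. c)"]) auto

lemma smooth_zero [simp]: "smooth 0"
  using smooth_const[of 0] by (simp only: zero_fun_def)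

lemma times_cont_diff_add:
  "times_cont_diff r f \<Longrightarrow> times_cont_diff r g \<Longrightarrow> times_cont_diff r (\<lambda>x. f x + g x)"
proof (induction r arbitrary: f g)
  case 0
  then show ?case by (auto intro: continuous_on_add)
next
  case (Suc r)
  have "((\<lambda>x. f x + g x) has_derivative
      (\<lambda>v. frechet_derivative f (at x) v + frechet_derivative g (at x) v)) (at x)" for x
    using Suc.prems by (intro has_derivative_add) (simp_all add: frechet_derivative_works[symmetric])
  note d = this frechet_derivative_at[OF this, symmetric]
  have "times_cont_diff r (\<lambda>x. frechet_derivative f (at x) v + frechet_derivative g (at x) v)" for v
    using Suc.prems by (intro Suc.IH) simp_all
  then show ?case using d by (auto simp: differentiable_def)
qed

lemma bounded_linear_frechet_derivative:
  assumes "bounded_linear L" "f differentiable (at x)"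
  shows "frechet_derivative (\<lambda>x. L (f x)) (at x) = (\<lambda>v. L (frechet_derivative f (at x) v))"
  using bounded_linear.has_derivative[OF assms(1) assms(2)[unfolded frechet_derivative_works]]
  by (rule frechet_derivative_at[symmetric])

lemma smooth_linear_image:
  assumes "bounded_linear L" "smooth f"
  shows "smooth (\<lambda>x. L (f x))"
proof (rule smooth_coinduct[where X = "\<lambda>h. \<exists>f. smooth f \<and> h = (\<lambda>x. L (f x))"])
  show "\<exists>g. smooth g \<and> (\<lambda>x. L (f x)) = (\<lambda>x. L (g x))" using assms by blast
next
  fix h x assume "\<exists>f. smooth f \<and> h = (\<lambda>x. L (f x))"
  then show "h differentiable (at x)"
    using assms(1) bounded_linear.has_derivative smooth_has_derivative
    unfolding differentiable_def by blast
next
  fix h v assume "\<exists>f. smooth f \<and> h = (\<lambda>x. L (f x))"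
  then obtain f where f: "smooth f" "h = (\<lambda>x. L (f x))" by blast
  then have "(\<lambda>x. frechet_derivative h (at x) v) = (\<lambda>x. L (frechet_derivative f (at x) v))"
    by (simp add: bounded_linear_frechet_derivative[OF assms(1) smooth_differentiable])
  then show "\<exists>f. smooth f \<and> (\<lambda>x. frechet_derivative h (at x) v) = (\<lambda>x. L (f x))"
    using smooth_frechet_derivative[OF f(1)] by blast
qed

text \<open>The derivative of a product is a sum of two products, so products alone are not a class
  for \<open>smooth_coinduct\<close>; induction on the order of differentiability handles
  them.\<close>

lemma times_cont_diff_mult:
  fixes f g :: "'a::real_normed_vector \<Rightarrow> 'b::real_normed_algebra"
  shows "times_cont_diff r f \<Longrightarrow> times_cont_diff r g \<Longrightarrow> times_cont_diff r (\<lambda>x. f x * g x)"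
proof (induction r arbitrary: f g)
  case 0
  then show ?case by (auto intro: continuous_on_mult)
next
  case (Suc r)
  have "((\<lambda>x. f x * g x) has_derivative
      (\<lambda>v. f x * frechet_derivative g (at x) v + frechet_derivative f (at x) v * g x)) (at x)" for x
    using Suc.prems by (intro has_derivative_mult) (simp_all add: frechet_derivative_works[symmetric])
  note d = this frechet_derivative_at[OF this, symmetric]
  have "times_cont_diff r (\<lambda>x. f x * frechet_derivative g (at x) v + frechet_derivative f (at x) v * g x)"
    for v
    \<comment> \<open>In each summand one factor is left undifferentiated; its order is lowered to
      match the induction hypothesis.\<close>
    using Suc.prems times_cont_diff_Suc_imp[OF Suc.prems(1)] times_cont_diff_Suc_imp[OF Suc.prems(2)]
    by (intro times_cont_diff_add Suc.IH) auto
  then show ?case using d by (auto simp: differentiable_def)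
qed

lemma smooth_add: "smooth f \<Longrightarrow> smooth g \<Longrightarrow> smooth (\<lambda>x. f x + g x)"
  by (simp add: smooth_def times_cont_diff_add)

lemma smooth_mult:
  fixes f g :: "'a::real_normed_vector \<Rightarrow> 'b::real_normed_algebra"
  shows "smooth f \<Longrightarrow> smooth g \<Longrightarrow> smooth (\<lambda>x. f x * g x)"
  by (simp add: smooth_def times_cont_diff_mult)

lemma smooth_uminus: "smooth f \<Longrightarrow> smooth (\<lambda>x. - f x)"
  by (rule smooth_linear_image[OF bounded_linear_minus[OF bounded_linear_ident]])

lemma times_cont_diff_sum:
  "(\<And>i. i \<in> A \<Longrightarrow> times_cont_diff r (f i)) \<Longrightarrow> times_cont_diff r (\<lambda>x. \<Sum>i\<in>A. f i x)"
proof (induction A rule: infinite_finite_induct)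
  case (insert i A)
  then show ?case by (simp add: times_cont_diff_add)
qed (use smooth_const[unfolded smooth_def] in auto)

lemma smooth_sum: "(\<And>i. i \<in> A \<Longrightarrow> smooth (f i)) \<Longrightarrow> smooth (\<lambda>x. \<Sum>i\<in>A. f i x)"
  by (simp add: smooth_def times_cont_diff_sum)

lemma smooth_partial: "smooth f \<Longrightarrow> smooth (partial i f)"
  unfolding partial_def by (rule smooth_frechet_derivative)

text \<open>Linearity in \<open>v\<close>, expanded in the standard basis. It turns the chain rule
  into a sum of products of scalar functions, on which sums and products of smooth functions
  apply.\<close>

lemma frechet_derivative_partial:
  fixes f :: "real^'d::finite \<Rightarrow> complex"
  assumes "smooth f"
  shows "frechet_derivative f (at x) v = (\<Sum>j\<in>UNIV. complex_of_real (v $ j) * partial j f x)"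
proof -
  have lin: "linear (frechet_derivative f (at x))"
    using smooth_has_derivative[OF assms] has_derivative_linear by blast
  have "frechet_derivative f (at x) v
      = frechet_derivative f (at x) (\<Sum>j\<in>UNIV. (v $ j) *\<^sub>R axis j 1)"
    by (simp add: basis_expansion flip: scalar_mult_eq_scaleR)
  also have "\<dots> = (\<Sum>j\<in>UNIV. (v $ j) *\<^sub>R frechet_derivative f (at x) (axis j 1))"
    by (simp add: linear_sum[OF lin] linear_scale[OF lin] o_def)
  finally show ?thesis by (simp add: partial_def scaleR_conv_of_real)
qed

lemma has_derivative_smooth_comp:
  fixes f :: "real^'d::finite \<Rightarrow> complex" and \<eta> :: "real^'e::finite \<Rightarrow> real^'d"
  assumes "smooth f" "smooth \<eta>"
  shows "((\<lambda>x. f (\<eta> x)) has_derivative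
    (\<lambda>v. \<Sum>j\<in>UNIV. complex_of_real (frechet_derivative \<eta> (at x) v $ j) * partial j f (\<eta> x))) (at x)"
proof -
  have "((\<lambda>x. f (\<eta> x)) has_derivative
     (\<lambda>v. frechet_derivative f (at (\<eta> x)) (frechet_derivative \<eta> (at x) v))) (at x)"
    using diff_chain_at[OF smooth_has_derivative[OF assms(2)] smooth_has_derivative[OF assms(1)]]
    by (simp add: o_def)
  then show ?thesis using frechet_derivative_partial[OF assms(1)] by simp
qed

lemma smooth_component:
  assumes "smooth \<eta>"
  shows "smooth (\<lambda>x. complex_of_real (\<eta> x $ j))"
  using smooth_linear_image[OF bounded_linear_of_real smooth_linear_image[OF bounded_linear_vec_nth assms]] .

text \<open>Each derivative of the composite is a sum of components of the derivative of \<eta>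
  times partial derivatives of \<open>f\<close> composed with \<eta>, so the induction must range
  over all smooth \<open>f\<close>.\<close>

lemma smooth_comp:
  fixes f :: "real^'d::finite \<Rightarrow> complex" and \<eta> :: "real^'e::finite \<Rightarrow> real^'d"
  assumes "smooth f" "smooth \<eta>"
  shows "smooth (\<lambda>x. f (\<eta> x))"
proof -
  have "times_cont_diff r (\<lambda>x. f (\<eta> x))" for r
    using assms(1)
  proof (induction r arbitrary: f)
    case 0
    then show ?case
      using continuous_on_compose2[OF smooth_continuous smooth_continuous[OF assms(2)]] by auto
  next
    case (Suc r)
    note d = has_derivative_smooth_comp[OF Suc.prems assms(2)]
    have "times_cont_diff r (\<lambda>x. \<Sum>j\<in>UNIV. complex_of_real (frechet_derivative \<eta> (at x) v $ j)
        * partial j f (\<eta> x))" for v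
      using Suc.IH[OF smooth_partial[OF Suc.prems]]
        smooth_component[OF smooth_frechet_derivative[OF assms(2)]]
      by (intro times_cont_diff_sum times_cont_diff_mult) (auto simp: smooth_def)
    then show ?case
      using d frechet_derivative_at[OF d, symmetric] by (auto simp: differentiable_def)
  qed
  then show ?thesis by (simp add: smooth_def)
qed

lemma partial_comp:
  fixes f :: "real^'d::finite \<Rightarrow> complex" and \<eta> :: "real^'e::finite \<Rightarrow> real^'d"
  assumes "smooth f" "smooth \<eta>"
  shows "partial i (\<lambda>x. f (\<eta> x)) =
    (\<lambda>x. \<Sum>j\<in>UNIV. complex_of_real (frechet_derivative \<eta> (at x) (axis i 1) $ j) * partial j f (\<eta> x))"
  unfolding partial_def[of i] by (simp add: frechet_derivative_at[OF has_derivative_smooth_comp[OF assms], symmetric])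

lemma partial_add:
  assumes "smooth f" "smooth g"
  shows "partial i (\<lambda>x. f x + g x) = (\<lambda>x. partial i f x + partial i g x)"
  unfolding partial_def
  by (simp add: frechet_derivative_at[OF has_derivative_add[OF smooth_has_derivative[OF assms(1)]
        smooth_has_derivative[OF assms(2)]], symmetric])

lemma partial_mult:
  assumes "smooth f" "smooth g"
  shows "partial i (\<lambda>x. f x * g x) = (\<lambda>x. partial i f x * g x + f x * partial i g x)"
  unfolding partial_def
  by (simp add: frechet_derivative_at[OF has_derivative_mult[OF smooth_has_derivative[OF assms(1)]
        smooth_has_derivative[OF assms(2)]], symmetric] add.commute)

lemma partial_const: "partial i (\<lambda>x. c) = (\<lambda>x. 0)"
  by (simp add: partial_def)

lemma partial_sum:
  "(\<And>a. a \<in> A \<Longrightarrow> smooth (f a)) \<Longrightarrow>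
    partial i (\<lambda>x. \<Sum>a\<in>A. f a x) = (\<lambda>x. \<Sum>a\<in>A. partial i (f a) x)"
proof (induction A rule: infinite_finite_induct)
  case (insert a A)
  then show ?case by (simp add: partial_add smooth_sum)
qed (simp_all add: partial_const)

text \<open>Both mixed derivatives are limits of the same second difference quotient, by the mean value
  theorem applied in either order.\<close>

lemma second_difference_mvt:
  fixes f :: "'a::real_normed_vector \<Rightarrow> real"
  assumes "smooth f" "s > 0"
  obtains \<sigma> \<tau> where "0 < \<sigma>" "\<sigma> < s" "0 < \<tau>" "\<tau> < s"
    "f (x + s *\<^sub>R u + s *\<^sub>R v) - f (x + s *\<^sub>R u) - f (x + s *\<^sub>R v) + f x =
     s * s * frechet_derivative (\<lambda>y. frechet_derivative f (at y) u) (at (x + \<sigma> *\<^sub>R u + \<tau> *\<^sub>R v)) v"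
proof -
  have line: "((\<lambda>t. g (y + t *\<^sub>R w)) has_derivative
      (\<lambda>h. h * frechet_derivative g (at (y + t *\<^sub>R w)) w)) (at t)"
    if "smooth g" for g :: "'a \<Rightarrow> real" and y w t
  proof -
    have "((\<lambda>t. y + t *\<^sub>R w) has_derivative (\<lambda>h. h *\<^sub>R w)) (at t)"
      by (auto intro!: derivative_eq_intros)
    from diff_chain_at[OF this smooth_has_derivative[OF that]]
    have "((\<lambda>t. g (y + t *\<^sub>R w)) has_derivative
       (\<lambda>h. frechet_derivative g (at (y + t *\<^sub>R w)) (h *\<^sub>R w))) (at t)"
      by (simp add: o_def)
    then show ?thesis
      using linear_scale[OF has_derivative_linear[OF smooth_has_derivative[OF that]]] by simp
  qed
  \<comment> \<open>The second difference is \<open>?F s - ?F 0\<close>: the mean value theorem is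
    used once along \<open>u\<close> for \<open>?F\<close>, then once along \<open>v\<close> for the
    derivative of \<open>f\<close> in direction \<open>u\<close>.\<close>
  let ?F = "\<lambda>t. f (x + s *\<^sub>R v + t *\<^sub>R u) - f (x + t *\<^sub>R u)"
  have dF: "(?F has_derivative (\<lambda>h. h * frechet_derivative f (at (x + s *\<^sub>R v + t *\<^sub>R u)) u
      - h * frechet_derivative f (at (x + t *\<^sub>R u)) u)) (at t)" for t
    by (intro has_derivative_diff line assms)
  obtain \<sigma> where \<sigma>: "0 < \<sigma>" "\<sigma> < s" "?F s - ?F 0 =
      s * frechet_derivative f (at (x + s *\<^sub>R v + \<sigma> *\<^sub>R u)) u
      - s * frechet_derivative f (at (x + \<sigma> *\<^sub>R u)) u"
    using mvt_simple[OF \<open>s > 0\<close>, of ?F, OF has_derivative_at_withinI[OF dF]] by auto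
  let ?g = "\<lambda>y. frechet_derivative f (at y) u"
  obtain \<tau> where \<tau>: "0 < \<tau>" "\<tau> < s" "?g (x + \<sigma> *\<^sub>R u + s *\<^sub>R v) - ?g (x + \<sigma> *\<^sub>R u) =
      s * frechet_derivative ?g (at (x + \<sigma> *\<^sub>R u + \<tau> *\<^sub>R v)) v"
    using mvt_simple[OF \<open>s > 0\<close>, of "\<lambda>t. ?g (x + \<sigma> *\<^sub>R u + t *\<^sub>R v)",
        OF has_derivative_at_withinI[OF line[OF smooth_frechet_derivative[OF assms(1)]]]] by auto
  have "?F s - ?F 0 = s * (?g (x + \<sigma> *\<^sub>R u + s *\<^sub>R v) - ?g (x + \<sigma> *\<^sub>R u))"
    using \<sigma>(3) by (simp add: algebra_simps)
  then show ?thesis using \<sigma> \<tau> that[of \<sigma> \<tau>] by (simp add: algebra_simps)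
qed

lemma real_mixed_derivatives_commute:
  fixes f :: "'a::real_normed_vector \<Rightarrow> real"
  assumes f: "smooth f"
  shows "frechet_derivative (\<lambda>y. frechet_derivative f (at y) u) (at x) v =
    frechet_derivative (\<lambda>y. frechet_derivative f (at y) v) (at x) u"
proof -
  define s where "s n = inverse (real (Suc n))" for n
  have s: "s n > 0" for n by (simp add: s_def)
  have s0: "s \<longlonglongrightarrow> 0" unfolding s_def by (rule LIMSEQ_inverse_real_of_nat)
  define D where "D u v y = frechet_derivative (\<lambda>y. frechet_derivative f (at y) u) (at y) v" for u v y
  define \<Delta> where "\<Delta> n = f (x + s n *\<^sub>R u + s n *\<^sub>R v) - f (x + s n *\<^sub>R u) - f (x + s n *\<^sub>R v) + f x" for n
  have D: "isCont (D u v) y" for u v y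
    using smooth_continuous[OF smooth_frechet_derivative[OF smooth_frechet_derivative[OF f]]]
    unfolding D_def by (simp add: continuous_on_eq_continuous_at)
  \<comment> \<open>Stated for any pair of directions with second difference
    \<open>\<Delta>\<close>. As \<open>\<Delta>\<close> is symmetric in \<open>u\<close> and
    \<open>v\<close>, it applies to both orders, and the limits must coincide.\<close>
  have lim: "(\<lambda>n. \<Delta> n / (s n * s n)) \<longlonglongrightarrow> D u' v' x"
    if eq: "\<And>n. f (x + s n *\<^sub>R u' + s n *\<^sub>R v') - f (x + s n *\<^sub>R u') - f (x + s n *\<^sub>R v') + f x = \<Delta> n"
    for u' v'
  proof -
    have "\<exists>\<sigma> \<tau>. 0 < \<sigma> \<and> \<sigma> < s n \<and> 0 < \<tau> \<and> \<tau> < s n \<and>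
        \<Delta> n = s n * s n * D u' v' (x + \<sigma> *\<^sub>R u' + \<tau> *\<^sub>R v')" for n
      using second_difference_mvt[OF f s[of n], of x u' v'] unfolding eq D_def by metis
    then obtain \<sigma> \<tau> where st: "\<And>n. 0 < \<sigma> n" "\<And>n. \<sigma> n < s n" "\<And>n. 0 < \<tau> n" "\<And>n. \<tau> n < s n"
      and \<Delta>: "\<And>n. \<Delta> n = s n * s n * D u' v' (x + \<sigma> n *\<^sub>R u' + \<tau> n *\<^sub>R v')"
      by metis
    have "\<sigma> \<longlonglongrightarrow> 0" "\<tau> \<longlonglongrightarrow> 0"
      using st by (auto intro!: tendsto_sandwich[OF _ _ tendsto_const s0] always_eventually less_imp_le)
    then have "(\<lambda>n. x + \<sigma> n *\<^sub>R u' + \<tau> n *\<^sub>R v') \<longlonglongrightarrow> x + 0 *\<^sub>R u' + 0 *\<^sub>R v'"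
      by (intro tendsto_intros)
    then have "(\<lambda>n. D u' v' (x + \<sigma> n *\<^sub>R u' + \<tau> n *\<^sub>R v')) \<longlonglongrightarrow> D u' v' x"
      using isCont_tendsto_compose[OF D] by simp
    moreover have "D u' v' (x + \<sigma> n *\<^sub>R u' + \<tau> n *\<^sub>R v') = \<Delta> n / (s n * s n)" for n
      using \<Delta>[of n] s[of n] by simp
    ultimately show ?thesis by simp
  qed
  have "D u v x = D v u x"
    by (rule LIMSEQ_unique[OF lim lim]) (simp_all add: \<Delta>_def algebra_simps)
  then show ?thesis by (simp add: D_def)
qed

text \<open>The mean value theorem concerns real values, so the symmetry is tested on real and
  imaginary parts.\<close>

lemma partial_commute:
  fixes f :: "real^'d::finite \<Rightarrow> complex"
  assumes f: "smooth f"
  shows "partial i (partial j f) = partial j (partial i f)"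
proof
  fix x
  have L: "L (partial i (partial j f) x) = L (partial j (partial i f) x)"
    if L: "bounded_linear L" for L :: "complex \<Rightarrow> real"
  proof -
    have eq: "L (partial i (partial j f) x) =
        frechet_derivative (\<lambda>y. frechet_derivative (\<lambda>y. L (f y)) (at y) (axis j 1)) (at x) (axis i 1)" for i j
      using bounded_linear_frechet_derivative[OF L smooth_differentiable[OF f]]
        bounded_linear_frechet_derivative[OF L smooth_differentiable[OF smooth_frechet_derivative[OF f]]]
      by (simp add: partial_def)
    show ?thesis
      unfolding eq by (rule real_mixed_derivatives_commute[OF smooth_linear_image[OF L f]])
  qed
  show "partial i (partial j f) x = partial j (partial i f) x"
    by (intro complex_eqI L bounded_linear_Re bounded_linear_Im)
qed

section \<open>Iterated partial derivatives indexed by multi-indices\<close>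

lemma smooth_partial_funpow: "smooth f \<Longrightarrow> smooth ((partial i ^^ n) f)"
  by (induction n) (auto intro: smooth_partial)

lemma smooth_foldr_partial: "smooth f \<Longrightarrow> smooth (foldr (\<lambda>i. partial i ^^ \<alpha> i) is f)"
  by (induction "is") (auto intro: smooth_partial_funpow)

lemma smooth_Dop: "smooth f \<Longrightarrow> smooth (Dop \<alpha> f)"
  unfolding Dop_def partials_def by (intro smooth_mult smooth_const smooth_foldr_partial)

lemma partial_funpow_commute:
  "smooth f \<Longrightarrow> partial j ((partial i ^^ n) f) = (partial i ^^ n) (partial j f)"
proof (induction n)
  case (Suc n)
  then show ?case using partial_commute[OF smooth_partial_funpow[OF Suc.prems]] by simp
qed simp

lemma coords: "distinct (coords :: 'd::finite list)" "set (coords :: 'd list) = UNIV"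
proof -
  obtain xs :: "'d list" where "set xs = UNIV" "distinct xs"
    using finite_distinct_list[of "UNIV :: 'd set"] by auto
  then have "\<exists>xs :: 'd list. distinct xs \<and> set xs = UNIV" by blast
  from someI_ex[OF this] show "distinct (coords :: 'd list)" "set (coords :: 'd list) = UNIV"
    by (auto simp: coords_def)
qed

text \<open>The new derivative commutes inwards until it meets the block of its own coordinate,
  which occurs at most once because \<open>js\<close> is distinct.\<close>

lemma partial_foldr_partial:
  assumes f: "smooth f" and "distinct js"
  shows "partial j (foldr (\<lambda>i. partial i ^^ \<alpha> i) js f) =
    (if j \<in> set js then foldr (\<lambda>i. partial i ^^ (\<alpha>(j := Suc (\<alpha> j))) i) js f
     else foldr (\<lambda>i. partial i ^^ \<alpha> i) js (partial j f))"
  using assms(2)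
proof (induction js)
  case (Cons i js)
  let ?F = "foldr (\<lambda>i. partial i ^^ \<alpha> i)"
  let ?G = "foldr (\<lambda>i. partial i ^^ (\<alpha>(j := Suc (\<alpha> j))) i)"
  have comm: "partial j (?F (i # js) f) = (partial i ^^ \<alpha> i) (partial j (?F js f))"
    using partial_funpow_commute[OF smooth_foldr_partial[OF f]] by simp
  show ?case
  proof (cases "i = j")
    case True
    have "?G js f = ?F js f"
      using Cons.prems True by (intro foldr_cong refl) auto
    then have "?G (j # js) f = partial j ((partial j ^^ \<alpha> j) (?F js f))"
      by (simp del: fun_upd_apply add: fun_upd_same)
    then show ?thesis using True by simp
  next
    case False
    have "partial j (?F js f) = (if j \<in> set js then ?G js f else ?F js (partial j f))"
      using Cons.IH Cons.prems by simp
    then show ?thesis unfolding comm using False by simp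
  qed
qed simp

lemma mi_size_Suc: "mi_size (\<alpha>(j := Suc (\<alpha> j))) = Suc (mi_size \<alpha>)"
proof -
  have "(\<Sum>i\<in>UNIV - {j}. (\<alpha>(j := Suc (\<alpha> j))) i) = (\<Sum>i\<in>UNIV - {j}. \<alpha> i)"
    by (rule sum.cong) auto
  then show ?thesis
    by (simp add: mi_size_def sum.remove[of UNIV j])
qed

lemma partial_Dop:
  assumes "smooth f"
  shows "partial j (Dop \<alpha> f) = (\<lambda>x. \<i> * Dop (\<alpha>(j := Suc (\<alpha> j))) f x)"
proof -
  have "partial j (Dop \<alpha> f) = (\<lambda>x. \<i> powi (- int (mi_size \<alpha>)) * partial j (partials \<alpha> f) x)"
    unfolding Dop_def using smooth_foldr_partial[OF assms]
    by (subst partial_mult) (auto simp: partial_const partials_def)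
  also have "partial j (partials \<alpha> f) = partials (\<alpha>(j := Suc (\<alpha> j))) f"
    using partial_foldr_partial[OF assms coords(1)] by (simp add: partials_def coords(2))
  \<comment> \<open>Raising the size of the index by one divides the normalising power by
    \<open>\<i>\<close>, hence the compensating factor.\<close>
  also have "\<i> powi (- int (mi_size \<alpha>)) = \<i> * \<i> powi (- int (mi_size (\<alpha>(j := Suc (\<alpha> j)))))"
    by (simp add: mi_size_Suc power_int_minus field_simps flip: of_nat_Suc)
  finally show ?thesis by (simp only: Dop_def mult.assoc)
qed

lemma finite_mi_size: "finite {\<alpha> :: 'd::finite multi_index. mi_size \<alpha> \<le> n}"
proof (rule finite_subset)
  have "\<alpha> i \<le> mi_size \<alpha>" for \<alpha> :: "'d multi_index" and i
    unfolding mi_size_def by (rule member_le_sum) auto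
  then show "{\<alpha> :: 'd multi_index. mi_size \<alpha> \<le> n} \<subseteq> PiE UNIV (\<lambda>_. {..n})"
    using order_trans by (fastforce simp: PiE_def)
qed (auto intro: finite_PiE)

section \<open>Differential operators over a smooth map\<close>

text \<open>In the application \<eta> is \<open>inv_into UNIV \<phi>\<close>; the calculus is
  carried out over an arbitrary smooth map.\<close>

definition symbol_pdo ::
    "nat \<Rightarrow> (real^'d \<Rightarrow> real^'d) \<Rightarrow> ('d multi_index \<Rightarrow> real^'d \<Rightarrow> complex) \<Rightarrow>
     (real^'d \<Rightarrow> complex) \<Rightarrow> real^'d::finite \<Rightarrow> complex"
  where "symbol_pdo n \<eta> f \<psi> = (\<lambda>x. \<Sum>\<alpha> | mi_size \<alpha> \<le> n. f \<alpha> x * Dop \<alpha> \<psi> (\<eta> x))"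

text \<open>The coefficients are hidden behind an existential quantifier: closure properties with
  control of the order suffice, and the coefficients of a composition need never be written
  down.\<close>

definition is_pdo ::
    "nat \<Rightarrow> (real^'d \<Rightarrow> real^'d) \<Rightarrow> ((real^'d \<Rightarrow> complex) \<Rightarrow> real^'d::finite \<Rightarrow> complex) \<Rightarrow> bool"
  where "is_pdo n \<eta> T \<longleftrightarrow>
    (\<exists>f. (\<forall>\<alpha>. smooth (f \<alpha>)) \<and> (\<forall>\<psi>. smooth \<psi> \<longrightarrow> T \<psi> = symbol_pdo n \<eta> f \<psi>))"

lemma is_pdo_cong:
  "is_pdo n \<eta> S \<Longrightarrow> (\<And>\<psi>. smooth \<psi> \<Longrightarrow> T \<psi> = S \<psi>) \<Longrightarrow> is_pdo n \<eta> T"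
  unfolding is_pdo_def by metis

lemma smooth_symbol_pdo:
  assumes "\<forall>\<alpha>. smooth (f \<alpha>)" "smooth \<eta>" "smooth \<psi>"
  shows "smooth (symbol_pdo n \<eta> f \<psi>)"
  unfolding symbol_pdo_def using assms
  by (intro smooth_sum smooth_mult smooth_comp[OF smooth_Dop]) auto

lemma smooth_is_pdo: "is_pdo n \<eta> T \<Longrightarrow> smooth \<eta> \<Longrightarrow> smooth \<psi> \<Longrightarrow> smooth (T \<psi>)"
  unfolding is_pdo_def using smooth_symbol_pdo by metis

lemma is_pdo_zero: "is_pdo n \<eta> (\<lambda>\<psi> x. 0)"
  unfolding is_pdo_def by (rule exI[of _ "\<lambda>\<alpha> x. 0"]) (simp add: symbol_pdo_def)

lemma is_pdo_add:
  assumes "is_pdo n \<eta> S" "is_pdo n \<eta> T"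
  shows "is_pdo n \<eta> (\<lambda>\<psi> x. S \<psi> x + T \<psi> x)"
proof -
  obtain f g where "\<forall>\<alpha>. smooth (f \<alpha>)" "\<forall>\<psi>. smooth \<psi> \<longrightarrow> S \<psi> = symbol_pdo n \<eta> f \<psi>"
    "\<forall>\<alpha>. smooth (g \<alpha>)" "\<forall>\<psi>. smooth \<psi> \<longrightarrow> T \<psi> = symbol_pdo n \<eta> g \<psi>"
    using assms unfolding is_pdo_def by metis
  then show ?thesis unfolding is_pdo_def
    by (intro exI[of _ "\<lambda>\<alpha> x. f \<alpha> x + g \<alpha> x"])
      (auto simp: symbol_pdo_def sum.distrib distrib_right intro: smooth_add)
qed

lemma is_pdo_sum:
  "(\<And>a. a \<in> A \<Longrightarrow> is_pdo n \<eta> (T a)) \<Longrightarrow> is_pdo n \<eta> (\<lambda>\<psi> x. \<Sum>a\<in>A. T a \<psi> x)"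
  by (induction A rule: infinite_finite_induct) (simp_all add: is_pdo_zero is_pdo_add)

lemma is_pdo_mult:
  assumes "smooth h" "is_pdo n \<eta> T"
  shows "is_pdo n \<eta> (\<lambda>\<psi> x. h x * T \<psi> x)"
proof -
  obtain f where "\<forall>\<alpha>. smooth (f \<alpha>)" "\<forall>\<psi>. smooth \<psi> \<longrightarrow> T \<psi> = symbol_pdo n \<eta> f \<psi>"
    using assms unfolding is_pdo_def by metis
  then show ?thesis unfolding is_pdo_def using assms(1)
    by (intro exI[of _ "\<lambda>\<alpha> x. h x * f \<alpha> x"])
      (auto simp: symbol_pdo_def sum_distrib_left mult.assoc intro: smooth_mult)
qed

lemma is_pdo_Dop:
  assumes "mi_size \<alpha> \<le> n"
  shows "is_pdo n \<eta> (\<lambda>\<psi> x. Dop \<alpha> \<psi> (\<eta> x))"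
  unfolding is_pdo_def
proof (intro exI[of _ "\<lambda>\<beta> x. if \<beta> = \<alpha> then 1 else 0"] conjI allI impI)
  fix \<psi> :: "real^'a \<Rightarrow> complex"
  show "(\<lambda>x. Dop \<alpha> \<psi> (\<eta> x)) = symbol_pdo n \<eta> (\<lambda>\<beta> x. if \<beta> = \<alpha> then 1 else 0) \<psi>"
    unfolding symbol_pdo_def using assms
    by (simp add: if_distrib[of "\<lambda>c. c * _"] finite_mi_size cong: if_cong)
qed auto

lemma is_pdo_comp_right:
  assumes "is_pdo n \<eta> T" "smooth \<theta>"
  shows "is_pdo n (\<eta> \<circ> \<theta>) (\<lambda>\<psi> x. T \<psi> (\<theta> x))"
proof -
  obtain f where "\<forall>\<alpha>. smooth (f \<alpha>)" "\<forall>\<psi>. smooth \<psi> \<longrightarrow> T \<psi> = symbol_pdo n \<eta> f \<psi>"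
    using assms unfolding is_pdo_def by metis
  then show ?thesis unfolding is_pdo_def using assms(2)
    by (intro exI[of _ "\<lambda>\<alpha> x. f \<alpha> (\<theta> x)"]) (simp_all add: symbol_pdo_def smooth_comp[OF _ assms(2)])
qed

lemma is_pdo_mono:
  assumes "is_pdo n \<eta> T" "n \<le> m"
  shows "is_pdo m \<eta> T"
proof -
  obtain f where f: "\<forall>\<alpha>. smooth (f \<alpha>)" "\<forall>\<psi>. smooth \<psi> \<longrightarrow> T \<psi> = symbol_pdo n \<eta> f \<psi>"
    using assms unfolding is_pdo_def by metis
  \<comment> \<open>\<open>f\<close> may be nonzero at indices of size above \<open>n\<close>, so it
    cannot serve as coefficient family for \<open>m\<close>; the operator is reassembled from its
    terms instead.\<close>
  have "is_pdo m \<eta> (\<lambda>\<psi> x. \<Sum>\<alpha> | mi_size \<alpha> \<le> n. f \<alpha> x * Dop \<alpha> \<psi> (\<eta> x))"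
    using f(1) assms(2) by (intro is_pdo_sum is_pdo_mult is_pdo_Dop) auto
  then show ?thesis by (rule is_pdo_cong) (simp add: f symbol_pdo_def)
qed

text \<open>By the Leibniz rule the derivative falls either on a coefficient, keeping the order, or
  on the derivative of \<psi> composed with \<eta>, where the chain rule raises the order by
  one.\<close>

lemma is_pdo_partial:
  assumes T: "is_pdo n \<eta> T" and \<eta>: "smooth \<eta>"
  shows "is_pdo (Suc n) \<eta> (\<lambda>\<psi>. partial i (T \<psi>))"
proof -
  obtain f where f: "\<forall>\<alpha>. smooth (f \<alpha>)" "\<forall>\<psi>. smooth \<psi> \<longrightarrow> T \<psi> = symbol_pdo n \<eta> f \<psi>"
    using T unfolding is_pdo_def by metis
  \<comment> \<open>\<open>?c j\<close> is the partial derivative in direction \<open>i\<close> of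
    the component \<open>j\<close> of \<eta>, an entry of the Jacobian matrix.\<close>
  let ?c = "\<lambda>j x. complex_of_real (frechet_derivative \<eta> (at x) (axis i 1) $ j)"
  let ?S = "\<lambda>\<psi> x. \<Sum>\<alpha> | mi_size \<alpha> \<le> n. partial i (f \<alpha>) x * Dop \<alpha> \<psi> (\<eta> x) +
      f \<alpha> x * (\<Sum>j\<in>UNIV. ?c j x * (\<i> * Dop (\<alpha>(j := Suc (\<alpha> j))) \<psi> (\<eta> x)))"
  have "is_pdo (Suc n) \<eta> ?S"
    using f(1) smooth_component[OF smooth_frechet_derivative[OF \<eta>]]
    by (intro is_pdo_sum is_pdo_add is_pdo_mult is_pdo_Dop smooth_partial smooth_const)
      (auto simp: mi_size_Suc)
  moreover have "partial i (T \<psi>) = ?S \<psi>" if \<psi>: "smooth \<psi>" for \<psi>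
  proof -
    have "partial i (T \<psi>) = (\<lambda>x. \<Sum>\<alpha> | mi_size \<alpha> \<le> n.
        partial i (\<lambda>x. f \<alpha> x * Dop \<alpha> \<psi> (\<eta> x)) x)"
      using f \<psi> by (simp add: symbol_pdo_def partial_sum smooth_mult smooth_comp[OF smooth_Dop[OF \<psi>] \<eta>])
    also have "\<dots> = ?S \<psi>"
      using f(1) by (simp add: partial_mult smooth_comp[OF smooth_Dop[OF \<psi>] \<eta>]
          partial_comp[OF smooth_Dop[OF \<psi>] \<eta>] partial_Dop[OF \<psi>])
    finally show ?thesis .
  qed
  ultimately show ?thesis by (rule is_pdo_cong)
qed

lemma is_pdo_partial_funpow:
  "is_pdo n \<eta> T \<Longrightarrow> smooth \<eta> \<Longrightarrow> is_pdo (n + k) \<eta> (\<lambda>\<psi>. (partial i ^^ k) (T \<psi>))"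
  by (induction k) (auto dest: is_pdo_partial)

lemma is_pdo_foldr_partial:
  assumes "is_pdo n \<eta> T" "smooth \<eta>"
  shows "is_pdo (n + sum_list (map \<alpha> js)) \<eta> (\<lambda>\<psi>. foldr (\<lambda>i. partial i ^^ \<alpha> i) js (T \<psi>))"
proof (induction js)
  case (Cons j js)
  from is_pdo_partial_funpow[OF this assms(2), of "\<alpha> j" j]
  show ?case by (simp add: ac_simps)
qed (simp add: assms)

lemma is_pdo_Dop_comp:
  assumes "is_pdo n \<eta> T" "smooth \<eta>"
  shows "is_pdo (n + mi_size \<alpha>) \<eta> (\<lambda>\<psi>. Dop \<alpha> (T \<psi>))"
proof -
  have "sum_list (map \<alpha> coords) = mi_size \<alpha>"
    by (simp add: mi_size_def sum.distinct_set_conv_list[OF coords(1), symmetric] coords(2))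
  then have "is_pdo (n + mi_size \<alpha>) \<eta> (\<lambda>\<psi>. partials \<alpha> (T \<psi>))"
    using is_pdo_foldr_partial[OF assms, of \<alpha> coords] by (simp add: partials_def)
  then show ?thesis unfolding Dop_def by (rule is_pdo_mult[OF smooth_const])
qed

text \<open>The source of the existence of star products. The maps compose in reverse order, since
  evaluating \<open>T \<psi>\<close> at \<open>\<theta> x\<close> evaluates \<psi> at
  \<open>\<eta> (\<theta> x)\<close>. A term of \<open>S\<close> of order at most \<open>m\<close>
  raises the order of \<open>T\<close> by at most \<open>m\<close>, and \<open>is_pdo_mono\<close>
  makes the bound uniform.\<close>

lemma is_pdo_comp:
  assumes S: "is_pdo m \<theta> S" and T: "is_pdo n \<eta> T" and "smooth \<theta>" "smooth \<eta>"
  shows "is_pdo (m + n) (\<eta> \<circ> \<theta>) (\<lambda>\<psi>. S (T \<psi>))"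
proof -
  obtain f where f: "\<forall>\<alpha>. smooth (f \<alpha>)" "\<forall>\<psi>. smooth \<psi> \<longrightarrow> S \<psi> = symbol_pdo m \<theta> f \<psi>"
    using S unfolding is_pdo_def by metis
  have "is_pdo (m + n) (\<eta> \<circ> \<theta>) (\<lambda>\<psi> x. \<Sum>\<alpha> | mi_size \<alpha> \<le> m. f \<alpha> x * Dop \<alpha> (T \<psi>) (\<theta> x))"
    using f(1) assms
    by (intro is_pdo_sum is_pdo_mult is_pdo_comp_right is_pdo_mono[OF is_pdo_Dop_comp[OF T]]) auto
  then show ?thesis
    by (rule is_pdo_cong) (simp add: f symbol_pdo_def smooth_is_pdo[OF T \<open>smooth \<eta>\<close>])
qed

section \<open>Plane waves and the recovery of coefficients\<close>

definition plane_wave :: "real^'d \<Rightarrow> real^'d::finite \<Rightarrow> complex"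
  where "plane_wave \<xi> = (\<lambda>y. exp (\<i> * complex_of_real (\<xi> \<bullet> y)))"

text \<open>The scalar \<open>c\<close> is carried along because differentiation maps multiples of a
  plane wave to multiples of the same wave; this closure gives smoothness and all iterated
  derivatives.\<close>

lemma plane_wave_has_derivative:
  "((\<lambda>y. c * plane_wave \<xi> y) has_derivative
     (\<lambda>v. (c * \<i> * complex_of_real (\<xi> \<bullet> v)) * plane_wave \<xi> y)) (at y)"
proof -
  have "((\<lambda>y. \<i> * complex_of_real (\<xi> \<bullet> y)) has_derivative (\<lambda>v. \<i> * complex_of_real (\<xi> \<bullet> v))) (at y)"
    by (auto intro!: derivative_eq_intros)
  then have "((\<lambda>y. c * exp (\<i> * complex_of_real (\<xi> \<bullet> y))) has_derivative
     (\<lambda>v. c * (exp (\<i> * complex_of_real (\<xi> \<bullet> y)) * (\<i> * complex_of_real (\<xi> \<bullet> v))))) (at y)"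
    by (intro has_derivative_mult_right)
      (rule has_derivative_compose[OF _ DERIV_exp[unfolded has_field_derivative_def], simplified])
  then show ?thesis by (simp add: plane_wave_def mult_ac)
qed

lemma smooth_plane_wave: "smooth (plane_wave \<xi>)"
proof (rule smooth_coinduct[where X = "\<lambda>h. \<exists>c. h = (\<lambda>y. c * plane_wave \<xi> y)"])
  show "\<exists>c. plane_wave \<xi> = (\<lambda>y. c * plane_wave \<xi> y)" by (rule exI[of _ 1]) simp
next
  fix h x assume "\<exists>c. h = (\<lambda>y. c * plane_wave \<xi> y)"
  then show "h differentiable at x"
    using plane_wave_has_derivative unfolding differentiable_def by blast
next
  fix h v assume "\<exists>c. h = (\<lambda>y. c * plane_wave \<xi> y)"
  then obtain c where "h = (\<lambda>y. c * plane_wave \<xi> y)" by blast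
  then show "\<exists>c. (\<lambda>x. frechet_derivative h (at x) v) = (\<lambda>y. c * plane_wave \<xi> y)"
    by (intro exI[of _ "c * \<i> * complex_of_real (\<xi> \<bullet> v)"])
      (simp add: frechet_derivative_at[OF plane_wave_has_derivative, symmetric])
qed

lemma partial_plane_wave:
  "partial i (\<lambda>y. c * plane_wave \<xi> y) = (\<lambda>y. (c * (\<i> * complex_of_real (\<xi> $ i))) * plane_wave \<xi> y)"
  unfolding partial_def frechet_derivative_at[OF plane_wave_has_derivative, symmetric]
  by (simp add: inner_axis mult.assoc)

lemma partial_funpow_plane_wave:
  "(partial i ^^ n) (\<lambda>y. c * plane_wave \<xi> y) =
    (\<lambda>y. (c * (\<i> * complex_of_real (\<xi> $ i)) ^ n) * plane_wave \<xi> y)"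
proof (induction n)
  case (Suc n)
  then show ?case
    using partial_plane_wave[of i "c * (\<i> * complex_of_real (\<xi> $ i)) ^ n" \<xi>] by (simp add: mult_ac)
qed simp

lemma foldr_partial_plane_wave:
  "foldr (\<lambda>i. partial i ^^ \<alpha> i) js (\<lambda>y. c * plane_wave \<xi> y) =
    (\<lambda>y. (c * (\<Prod>i\<leftarrow>js. (\<i> * complex_of_real (\<xi> $ i)) ^ \<alpha> i)) * plane_wave \<xi> y)"
proof (induction js)
  case (Cons j js)
  then show ?case
    using partial_funpow_plane_wave[of "\<alpha> j" j
        "c * (\<Prod>i\<leftarrow>js. (\<i> * complex_of_real (\<xi> $ i)) ^ \<alpha> i)" \<xi>]
    by (simp add: mult_ac)
qed simp

text \<open>A plane wave is a joint eigenfunction of all \<open>Dop \<alpha>\<close>: the powers of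
  \<open>\<i>\<close> produced by differentiation cancel the normalisation, and the eigenvalue is
  exactly the monomial.\<close>

lemma Dop_plane_wave: "Dop \<alpha> (plane_wave \<xi>) = (\<lambda>y. monomial \<alpha> \<xi> * plane_wave \<xi> y)"
proof -
  have "(\<Prod>i\<leftarrow>coords. (\<i> * complex_of_real (\<xi> $ i)) ^ \<alpha> i) =
      (\<Prod>i\<in>UNIV. (\<i> * complex_of_real (\<xi> $ i)) ^ \<alpha> i)"
    by (simp add: prod.distinct_set_conv_list[OF coords(1), symmetric] coords(2))
  also have "\<dots> = \<i> ^ mi_size \<alpha> * monomial \<alpha> \<xi>"
    by (simp add: power_mult_distrib prod.distrib monomial_def mi_size_def power_sum)
  finally have "partials \<alpha> (plane_wave \<xi>) = (\<lambda>y. \<i> ^ mi_size \<alpha> * monomial \<alpha> \<xi> * plane_wave \<xi> y)"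
    using foldr_partial_plane_wave[of \<alpha> coords 1 \<xi>] by (simp add: partials_def)
  then show ?thesis by (simp add: Dop_def power_int_minus field_simps)
qed

text \<open>Monomials are pairwise distinct characters of the multiplicative monoid of \<open>\<xi>\<close>'s, so this is
  Dedekind's argument for the linear independence of characters.\<close>

lemma monomials_independent:
  fixes c :: "'d::finite multi_index \<Rightarrow> complex"
  assumes "finite A" "\<And>\<xi>. (\<Sum>\<alpha>\<in>A. c \<alpha> * monomial \<alpha> \<xi>) = 0" "\<alpha> \<in> A"
  shows "c \<alpha> = 0"
  using assms
proof (induction A arbitrary: c \<alpha> rule: finite_psubset_induct)
  case (psubset A)
  have other: "c \<gamma> = 0" if "\<gamma> \<in> A" "\<beta> \<in> A" "\<gamma> \<noteq> \<beta>" for \<beta> \<gamma>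
  proof -
    from that(3) obtain i where i: "\<gamma> i \<noteq> \<beta> i" by auto
    \<comment> \<open>A point that separates the two monomials: they take there the values
      \<open>2 ^ \<gamma> i\<close> and \<open>2 ^ \<beta> i\<close>, which differ because \<gamma>
      and \<beta> differ at \<open>i\<close>.\<close>
    define \<zeta> :: "real^'d" where "\<zeta> = (\<chi> j. if j = i then 2 else 1)"
    have "monomial \<delta> \<zeta> = (\<Prod>j\<in>UNIV. if j = i then 2 ^ \<delta> i else 1)" for \<delta>
      unfolding monomial_def \<zeta>_def by (rule prod.cong) auto
    then have two: "monomial \<delta> \<zeta> = 2 ^ \<delta> i" for \<delta> by simp
    have mult: "monomial \<delta> (\<chi> j. \<zeta> $ j * \<xi> $ j) = monomial \<delta> \<zeta> * monomial \<delta> \<xi>" for \<delta> and \<xi> :: "real^'d"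
      by (simp add: monomial_def power_mult_distrib prod.distrib)
    \<comment> \<open>Multiplying the argument by \<zeta> scales each monomial by its value at
      \<zeta>. Subtracting \<open>2 ^ \<beta> i\<close> times the original relation removes the
      index \<beta>, leaving a shorter relation.\<close>
    have "(\<Sum>\<delta>\<in>A - {\<beta>}. c \<delta> * (2 ^ \<delta> i - 2 ^ \<beta> i) * monomial \<delta> \<xi>) = 0" for \<xi>
    proof -
      have "(\<Sum>\<delta>\<in>A - {\<beta>}. c \<delta> * (2 ^ \<delta> i - 2 ^ \<beta> i) * monomial \<delta> \<xi>)
          = (\<Sum>\<delta>\<in>A. c \<delta> * (2 ^ \<delta> i - 2 ^ \<beta> i) * monomial \<delta> \<xi>)"
        using psubset.hyps that(2) by (simp add: sum.remove)
      also have "\<dots> = (\<Sum>\<delta>\<in>A. c \<delta> * monomial \<delta> (\<chi> j. \<zeta> $ j * \<xi> $ j))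
          - 2 ^ \<beta> i * (\<Sum>\<delta>\<in>A. c \<delta> * monomial \<delta> \<xi>)"
        unfolding mult two by (simp add: sum_distrib_left sum_subtractf algebra_simps)
      finally show ?thesis using psubset.prems(1) by simp
    qed
    then have "c \<gamma> * (2 ^ \<gamma> i - 2 ^ \<beta> i) = 0"
      using psubset.IH[of "A - {\<beta>}" "\<lambda>\<delta>. c \<delta> * (2 ^ \<delta> i - 2 ^ \<beta> i)" \<gamma>] that by blast
    moreover have "(2::complex) ^ \<gamma> i \<noteq> 2 ^ \<beta> i"
      using i power_inject_exp[of "2::real" "\<gamma> i" "\<beta> i"]
      by (metis of_real_eq_iff of_real_numeral of_real_power one_less_numeral_iff semiring_norm(76))
    ultimately show ?thesis by simp
  qed
  show ?case
  \<comment> \<open>Without a second index there is nothing to separate from; evaluation at the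
    point with all coordinates 1 settles this case.\<close>
  proof (cases "A = {\<alpha>}")
    case True
    have "monomial \<alpha> (\<chi> j. 1) = 1" by (simp add: monomial_def)
    then show ?thesis using psubset.prems(1)[of "\<chi> j. 1"] True by simp
  next
    case False
    then obtain \<beta> where "\<beta> \<in> A" "\<alpha> \<noteq> \<beta>" using psubset.prems(2) by blast
    then show ?thesis using other psubset.prems(2) by blast
  qed
qed

lemma symbol_of_inject:
  assumes "symbol_of n f = symbol_of n g" "mi_size \<alpha> \<le> n"
  shows "f \<alpha> = g \<alpha>"
proof
  fix x
  have "(\<Sum>\<alpha> | mi_size \<alpha> \<le> n. (f \<alpha> x - g \<alpha> x) * monomial \<alpha> \<xi>) = 0" for \<xi>
    using fun_cong[OF fun_cong[OF assms(1), of x], of \<xi>]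
    by (simp add: symbol_of_def left_diff_distrib sum_subtractf)
  from monomials_independent[OF finite_mi_size this] assms(2) show "f \<alpha> x = g \<alpha> x" by simp
qed

text \<open>Makes the definite description in \<open>symbol_coeff\<close> usable: truncation gives
  existence, and independence of the monomials gives uniqueness.\<close>

lemma symbol_coeff_symbol_of:
  assumes "\<forall>\<alpha>. smooth (f \<alpha>)"
  shows "symbol_coeff n (symbol_of n f) = (\<lambda>\<alpha>. if mi_size \<alpha> \<le> n then f \<alpha> else (\<lambda>x. 0))"
  unfolding symbol_coeff_def
proof (rule the_equality)
  show "(\<forall>\<alpha>. smooth (if mi_size \<alpha> \<le> n then f \<alpha> else (\<lambda>x. 0))) \<and>
    (\<forall>\<alpha>. n < mi_size \<alpha> \<longrightarrow> (if mi_size \<alpha> \<le> n then f \<alpha> else (\<lambda>x. 0)) = (\<lambda>x. 0)) \<and>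
    symbol_of n f = symbol_of n (\<lambda>\<alpha>. if mi_size \<alpha> \<le> n then f \<alpha> else (\<lambda>x. 0))"
    using assms by (auto simp: symbol_of_def intro!: ext sum.cong)
next
  fix g assume "(\<forall>\<alpha>. smooth (g \<alpha>)) \<and> (\<forall>\<alpha>. n < mi_size \<alpha> \<longrightarrow> g \<alpha> = (\<lambda>x. 0)) \<and>
    symbol_of n f = symbol_of n g"
  then show "g = (\<lambda>\<alpha>. if mi_size \<alpha> \<le> n then f \<alpha> else (\<lambda>x. 0))"
    using symbol_of_inject[of n g f] by (intro ext) auto
qed

section \<open>The ring of operators on smooth functions\<close>

text \<open>Operators are normalised to vanish on non-smooth functions, so that they form a ring.\<close>

definition smooth_endo :: "((real^'d \<Rightarrow> complex) \<Rightarrow> real^'d::finite \<Rightarrow> complex) \<Rightarrow> bool"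
  where "smooth_endo T \<longleftrightarrow>
    (\<forall>\<psi>. \<not> smooth \<psi> \<longrightarrow> T \<psi> = 0) \<and> (\<forall>\<psi>. smooth \<psi> \<longrightarrow> smooth (T \<psi>)) \<and>
    (\<forall>\<psi> \<theta>. smooth \<psi> \<longrightarrow> smooth \<theta> \<longrightarrow> T (\<psi> + \<theta>) = T \<psi> + T \<theta>)"

lemma smooth_endo_nonsmooth: "smooth_endo T \<Longrightarrow> \<not> smooth \<psi> \<Longrightarrow> T \<psi> = 0"
  by (simp add: smooth_endo_def)

lemma smooth_endo_smooth: "smooth_endo T \<Longrightarrow> smooth \<psi> \<Longrightarrow> smooth (T \<psi>)"
  by (simp add: smooth_endo_def)

lemma smooth_endo_add: "smooth_endo T \<Longrightarrow> smooth \<psi> \<Longrightarrow> smooth \<theta> \<Longrightarrow> T (\<psi> + \<theta>) = T \<psi> + T \<theta>"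
  by (simp add: smooth_endo_def)

lemma smooth_endo_zero: "smooth_endo T \<Longrightarrow> T 0 = 0"
  using smooth_endo_add[of T 0 0] by simp

text \<open>A type rather than a set of operators, so that it can be an instance of
  \<open>ring_1\<close> and the library's power series \<open>fps\<close> over it form a
  ring.\<close>

typedef (overloaded) ('d::finite) smooth_op =
  "{T :: (real^'d \<Rightarrow> complex) \<Rightarrow> real^'d \<Rightarrow> complex. smooth_endo T}"
  morphisms app Abs_smooth_op
  by (rule exI[of _ "\<lambda>\<psi>. 0"]) (simp add: smooth_endo_def)

setup_lifting type_definition_smooth_op

lemma smooth_fun_plus: "smooth f \<Longrightarrow> smooth g \<Longrightarrow> smooth (f + g)"
  unfolding plus_fun_def by (rule smooth_add)

lemma smooth_fun_uminus: "smooth f \<Longrightarrow> smooth (- f)"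
  unfolding fun_Compl_def by (rule smooth_uminus)

lemma smooth_fun_minus: "smooth f \<Longrightarrow> smooth g \<Longrightarrow> smooth (f - g)"
  using smooth_fun_plus[OF _ smooth_fun_uminus, of f g] by simp

instantiation smooth_op :: (finite) ring_1
begin

lift_definition zero_smooth_op :: "'a smooth_op" is "\<lambda>\<psi>. 0" by (simp add: smooth_endo_def)

lift_definition one_smooth_op :: "'a smooth_op" is "\<lambda>\<psi>. if smooth \<psi> then \<psi> else 0"
  by (simp add: smooth_endo_def smooth_fun_plus)

lift_definition plus_smooth_op :: "'a smooth_op \<Rightarrow> 'a smooth_op \<Rightarrow> 'a smooth_op" is "\<lambda>S T \<psi>. S \<psi> + T \<psi>"
  by (simp add: smooth_endo_def smooth_fun_plus)

lift_definition minus_smooth_op :: "'a smooth_op \<Rightarrow> 'a smooth_op \<Rightarrow> 'a smooth_op" is "\<lambda>S T \<psi>. S \<psi> - T \<psi>"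
  by (simp add: smooth_endo_def smooth_fun_minus)

lift_definition uminus_smooth_op :: "'a smooth_op \<Rightarrow> 'a smooth_op" is "\<lambda>T \<psi>. - T \<psi>"
  by (simp add: smooth_endo_def smooth_fun_uminus)

lift_definition times_smooth_op :: "'a smooth_op \<Rightarrow> 'a smooth_op \<Rightarrow> 'a smooth_op" is "\<lambda>S T \<psi>. S (T \<psi>)"
proof -
  fix S T :: "(real^'a \<Rightarrow> complex) \<Rightarrow> real^'a \<Rightarrow> complex"
  assume *: "smooth_endo S" "smooth_endo T"
  show "smooth_endo (\<lambda>\<psi>. S (T \<psi>))"
    unfolding smooth_endo_def[of "\<lambda>\<psi>. S (T \<psi>)"]
    by (intro conjI allI impI)
      (simp_all only: smooth_endo_nonsmooth[OF *(2)] smooth_endo_zero[OF *(1)] smooth_endo_smooth[OF *(1)]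
        smooth_endo_smooth[OF *(2)] smooth_endo_add[OF *(1)] smooth_endo_add[OF *(2)] not_False_eq_True)
qed

instance
proof
  fix a b c :: "'a smooth_op"
  show "a * b * c = a * (b * c)" by transfer simp
  show "a + b + c = a + (b + c)" by transfer (simp add: add.assoc)
  show "a + b = b + a" by transfer (simp add: add.commute)
  show "0 + a = a" by transfer simp
  show "- a + a = 0" by transfer simp
  show "a - b = a + - b" by transfer simp
  show "1 * a = a"
  proof transfer
    fix T :: "(real^'a \<Rightarrow> complex) \<Rightarrow> real^'a \<Rightarrow> complex"
    assume "smooth_endo T"
    then have "(if smooth (T \<psi>) then T \<psi> else 0) = T \<psi>" for \<psi>
      by (cases "smooth \<psi>") (simp_all add: smooth_endo_smooth smooth_endo_nonsmooth)
    then show "(\<lambda>\<psi>. if smooth (T \<psi>) then T \<psi> else 0) = T" by presburger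
  qed
  show "a * 1 = a"
    by transfer (rule ext, simp add: smooth_endo_zero smooth_endo_nonsmooth)
  show "(a + b) * c = a * c + b * c" by transfer simp
  \<comment> \<open>Here the additivity of the outer operator enters; the other distributive law is
    pointwise.\<close>
  show "a * (b + c) = a * b + a * c"
  proof transfer
    fix S T U :: "(real^'a \<Rightarrow> complex) \<Rightarrow> real^'a \<Rightarrow> complex"
    assume *: "smooth_endo S" "smooth_endo T" "smooth_endo U"
    have "S (T \<psi> + U \<psi>) = S (T \<psi>) + S (U \<psi>)" for \<psi>
      by (cases "smooth \<psi>") (simp_all only: smooth_endo_add[OF *(1)] smooth_endo_smooth[OF *(2)]
        smooth_endo_smooth[OF *(3)] smooth_endo_nonsmooth[OF *(2)] smooth_endo_nonsmooth[OF *(3)]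
        smooth_endo_zero[OF *(1)] not_False_eq_True add_0_left)
    then show "(\<lambda>\<psi>. S (T \<psi> + U \<psi>)) = (\<lambda>\<psi>. S (T \<psi>) + S (U \<psi>))" by simp
  qed
  show "(0::'a smooth_op) \<noteq> 1"
  proof transfer
    have "(0 :: real^'a \<Rightarrow> complex) \<noteq> (\<lambda>x. 1)" by (simp add: fun_eq_iff)
    then show "(\<lambda>\<psi>. 0) \<noteq> (\<lambda>\<psi> :: real^'a \<Rightarrow> complex. if smooth \<psi> then \<psi> else 0)"
      using smooth_const[of "1::complex"] by (metis (full_types))
  qed
qed

end

lemma smooth_app: "smooth \<psi> \<Longrightarrow> smooth (app T \<psi>)"
  by transfer (rule smooth_endo_smooth)

lemma app_add: "smooth \<psi> \<Longrightarrow> smooth \<theta> \<Longrightarrow> app T (\<lambda>x. \<psi> x + \<theta> x) = (\<lambda>x. app T \<psi> x + app T \<theta> x)"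
  using smooth_endo_add[of "app T" \<psi> \<theta>] app[of T] by (simp add: plus_fun_def)

lemma app_zero: "app T 0 = 0"
  by transfer (rule smooth_endo_zero)

lemma app_sum:
  "(\<And>i. i \<in> I \<Longrightarrow> smooth (f i)) \<Longrightarrow> app T (\<lambda>x. \<Sum>i\<in>I. f i x) = (\<lambda>x. \<Sum>i\<in>I. app T (f i) x)"
proof (induction I rule: infinite_finite_induct)
  case (insert i I)
  then show ?case by (simp add: app_add smooth_sum)
qed (use app_zero[of T] in \<open>simp_all add: zero_fun_def\<close>)

lemma app_zero_op: "app 0 \<psi> = (\<lambda>x. 0)"
  by transfer (simp add: zero_fun_def)

lemma app_plus: "app (S + T) \<psi> = (\<lambda>x. app S \<psi> x + app T \<psi> x)"
  by transfer (simp add: plus_fun_def)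

lemma app_times: "app (S * T) \<psi> = app S (app T \<psi>)"
  by transfer simp

lemma app_one: "smooth \<psi> \<Longrightarrow> app 1 \<psi> = \<psi>"
  by transfer simp

lemma app_op_sum: "app (\<Sum>i\<in>I. T i) \<psi> = (\<lambda>x. \<Sum>i\<in>I. app (T i) \<psi> x)"
  by (induction I rule: infinite_finite_induct) (simp_all add: app_plus app_zero_op)

text \<open>Off the smooth functions both operators vanish by normalisation.\<close>

lemma smooth_op_eqI: "(\<And>\<psi>. smooth \<psi> \<Longrightarrow> app S \<psi> = app T \<psi>) \<Longrightarrow> S = T"
proof transfer
  fix S T :: "(real^'a \<Rightarrow> complex) \<Rightarrow> real^'a \<Rightarrow> complex"
  assume *: "smooth_endo S" "smooth_endo T" and eq: "\<And>\<psi>. smooth \<psi> \<Longrightarrow> S \<psi> = T \<psi>"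
  show "S = T"
  proof
    fix \<psi> show "S \<psi> = T \<psi>"
      using * eq[of \<psi>] by (cases "smooth \<psi>") (simp_all add: smooth_endo_nonsmooth)
  qed
qed

section \<open>Symbols as elements of the operator ring\<close>

lemma Dop_add:
  assumes "smooth \<psi>" "smooth \<theta>"
  shows "Dop \<alpha> (\<lambda>x. \<psi> x + \<theta> x) = (\<lambda>x. Dop \<alpha> \<psi> x + Dop \<alpha> \<theta> x)"
proof -
  have funpow: "(partial i ^^ n) (\<lambda>x. f x + g x) = (\<lambda>x. (partial i ^^ n) f x + (partial i ^^ n) g x)"
    if "smooth f" "smooth g" for i n and f g :: "real^'a \<Rightarrow> complex"
    by (induction n) (simp_all add: partial_add smooth_partial_funpow that)
  have "foldr (\<lambda>i. partial i ^^ \<alpha> i) js (\<lambda>x. \<psi> x + \<theta> x) =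
      (\<lambda>x. foldr (\<lambda>i. partial i ^^ \<alpha> i) js \<psi> x + foldr (\<lambda>i. partial i ^^ \<alpha> i) js \<theta> x)" for js
    by (induction js) (simp_all add: funpow smooth_foldr_partial assms)
  then show ?thesis by (simp add: Dop_def partials_def distrib_left)
qed

lemma diffeo_smooth_inv: "diffeo \<phi> \<Longrightarrow> smooth (inv_into UNIV \<phi>)"
  by (simp add: diffeo_def)

lemma symbol_pdo_add:
  "smooth \<psi> \<Longrightarrow> smooth \<theta> \<Longrightarrow> symbol_pdo n \<eta> f (\<psi> + \<theta>) = symbol_pdo n \<eta> f \<psi> + symbol_pdo n \<eta> f \<theta>"
  by (simp add: symbol_pdo_def plus_fun_def Dop_add distrib_left sum.distrib)

text \<open>One homogeneous component of \<open>Op1\<close>, as a ring element. The abstraction is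
  meaningful for a diffeomorphism \<phi> and \<open>P \<in> Pol n\<close>, when the raw operator
  satisfies \<open>smooth_endo\<close>.\<close>

definition symbol_op :: "nat \<Rightarrow> (real^'d \<Rightarrow> real^'d) \<Rightarrow> 'd symbol \<Rightarrow> ('d::finite) smooth_op"
  where "symbol_op n \<phi> P = Abs_smooth_op (\<lambda>\<psi>. if smooth \<psi>
    then symbol_pdo n (inv_into UNIV \<phi>) (symbol_coeff n P) \<psi> else 0)"

lemma PolE:
  assumes "P \<in> Pol n"
  obtains f where "\<forall>\<alpha>. smooth (f \<alpha>)" "P = symbol_of n f"
  using assms unfolding Pol_def by blast

lemma smooth_symbol_coeff: "P \<in> Pol n \<Longrightarrow> smooth (symbol_coeff n P \<alpha>)"
  by (elim PolE) (simp add: symbol_coeff_symbol_of)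

lemma app_symbol_op:
  assumes "diffeo \<phi>" "P \<in> Pol n" "smooth \<psi>"
  shows "app (symbol_op n \<phi> P) \<psi> = symbol_pdo n (inv_into UNIV \<phi>) (symbol_coeff n P) \<psi>"
proof -
  have "app (symbol_op n \<phi> P) = (\<lambda>\<psi>. if smooth \<psi>
    then symbol_pdo n (inv_into UNIV \<phi>) (symbol_coeff n P) \<psi> else 0)"
    unfolding symbol_op_def
    using smooth_symbol_coeff[OF assms(2)] diffeo_smooth_inv[OF assms(1)]
    by (intro Abs_smooth_op_inverse) (simp add: smooth_endo_def smooth_fun_plus symbol_pdo_add smooth_symbol_pdo)
  then show ?thesis using assms(3) by simp
qed

lemma app_symbol_op_symbol_of:
  assumes "diffeo \<phi>" "\<forall>\<alpha>. smooth (f \<alpha>)" "smooth \<psi>"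
  shows "app (symbol_op n \<phi> (symbol_of n f)) \<psi> = symbol_pdo n (inv_into UNIV \<phi>) f \<psi>"
proof -
  have "symbol_of n f \<in> Pol n" using assms(2) unfolding Pol_def by blast
  then show ?thesis
    by (simp add: app_symbol_op assms(1,3) symbol_coeff_symbol_of[OF assms(2)] symbol_pdo_def)
qed

text \<open>Replacing each \<open>Dop \<alpha>\<close> by its eigenvalue turns the sum over \<alpha>
  into the symbol itself. Faithfulness of \<open>symbol_op\<close> rests on this.\<close>

lemma app_symbol_op_plane_wave:
  assumes "diffeo \<phi>" "P \<in> Pol n"
  shows "app (symbol_op n \<phi> P) (plane_wave \<xi>) x = P x \<xi> * plane_wave \<xi> (inv_into UNIV \<phi> x)"
proof -
  obtain f where f: "\<forall>\<alpha>. smooth (f \<alpha>)" "P = symbol_of n f" using assms(2) by (rule PolE)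
  show ?thesis
    unfolding f(2) app_symbol_op_symbol_of[OF assms(1) f(1) smooth_plane_wave]
    by (simp add: symbol_pdo_def Dop_plane_wave symbol_of_def sum_distrib_right mult.assoc)
qed

lemma symbol_op_inject:
  assumes "diffeo \<phi>" "P \<in> Pol n" "Q \<in> Pol n" "symbol_op n \<phi> P = symbol_op n \<phi> Q"
  shows "P = Q"
proof (intro ext)
  fix x \<xi>
  have "P x \<xi> * plane_wave \<xi> (inv_into UNIV \<phi> x) = app (symbol_op n \<phi> P) (plane_wave \<xi>) x"
    by (rule app_symbol_op_plane_wave[OF assms(1,2), symmetric])
  also have "\<dots> = Q x \<xi> * plane_wave \<xi> (inv_into UNIV \<phi> x)"
    unfolding assms(4) by (rule app_symbol_op_plane_wave[OF assms(1,3)])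
  finally have "P x \<xi> * plane_wave \<xi> (inv_into UNIV \<phi> x) = Q x \<xi> * plane_wave \<xi> (inv_into UNIV \<phi> x)" .
  \<comment> \<open>The exponential never vanishes and can be cancelled.\<close>
  then show "P x \<xi> = Q x \<xi>" by (simp add: plane_wave_def)
qed

lemma symbol_of_in_Pol: "\<forall>\<alpha>. smooth (f \<alpha>) \<Longrightarrow> symbol_of n f \<in> Pol n"
  unfolding Pol_def by blast

lemma symbol_of_add: "symbol_of n f + symbol_of n g = symbol_of n (\<lambda>\<alpha> x. f \<alpha> x + g \<alpha> x)"
  by (simp add: symbol_of_def plus_fun_def distrib_right sum.distrib)

lemma symbol_of_uminus: "- symbol_of n f = symbol_of n (\<lambda>\<alpha> x. - f \<alpha> x)"
  by (simp add: symbol_of_def fun_Compl_def sum_negf)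

lemma symbol_of_zero: "0 = symbol_of n (\<lambda>\<alpha> x. 0)"
  by (simp add: symbol_of_def zero_fun_def)

lemma Pol_zero: "0 \<in> Pol n"
  unfolding symbol_of_zero[of n] by (rule symbol_of_in_Pol) simp

lemma Pol_add: "P \<in> Pol n \<Longrightarrow> Q \<in> Pol n \<Longrightarrow> P + Q \<in> Pol n"
  by (elim PolE) (simp add: symbol_of_add symbol_of_in_Pol smooth_add)

lemma Pol_uminus: "P \<in> Pol n \<Longrightarrow> - P \<in> Pol n"
  by (elim PolE) (simp add: symbol_of_uminus symbol_of_in_Pol smooth_uminus)

lemma symbol_op_zero: "diffeo \<phi> \<Longrightarrow> symbol_op n \<phi> 0 = 0"
  by (rule smooth_op_eqI)
    (simp add: symbol_of_zero[of n] app_symbol_op_symbol_of app_zero_op symbol_pdo_def)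

lemma symbol_op_add:
  assumes "diffeo \<phi>" "P \<in> Pol n" "Q \<in> Pol n"
  shows "symbol_op n \<phi> (P + Q) = symbol_op n \<phi> P + symbol_op n \<phi> Q"
proof -
  obtain f g where f: "\<forall>\<alpha>. smooth (f \<alpha>)" "P = symbol_of n f" and g: "\<forall>\<alpha>. smooth (g \<alpha>)" "Q = symbol_of n g"
    using assms(2,3) by (elim PolE)
  show ?thesis
    by (rule smooth_op_eqI) (use f(1) g(1) in \<open>simp add: f(2) g(2) symbol_of_add app_symbol_op_symbol_of
      assms(1) smooth_add app_plus symbol_pdo_def distrib_right sum.distrib\<close>)
qed

lemma symbol_op_uminus:
  assumes "diffeo \<phi>" "P \<in> Pol n"
  shows "symbol_op n \<phi> (- P) = - symbol_op n \<phi> P"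
proof -
  have "symbol_op n \<phi> (- P) + symbol_op n \<phi> P = 0"
    using symbol_op_add[OF assms(1) Pol_uminus[OF assms(2)] assms(2)] symbol_op_zero[OF assms(1)] by simp
  then show ?thesis by (simp add: eq_neg_iff_add_eq_0)
qed

lemma symbol_op_surj:
  assumes "diffeo \<phi>" "is_pdo n (inv_into UNIV \<phi>) (app T)"
  obtains P where "P \<in> Pol n" "T = symbol_op n \<phi> P"
proof -
  obtain f where f: "\<forall>\<alpha>. smooth (f \<alpha>)"
    "\<forall>\<psi>. smooth \<psi> \<longrightarrow> app T \<psi> = symbol_pdo n (inv_into UNIV \<phi>) f \<psi>"
    using assms(2) unfolding is_pdo_def by blast
  have "T = symbol_op n \<phi> (symbol_of n f)"
    by (rule smooth_op_eqI) (simp add: f app_symbol_op_symbol_of[OF assms(1) f(1)])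
  then show ?thesis using that symbol_of_in_Pol[OF f(1)] by blast
qed

lemma is_pdo_symbol_op:
  assumes "diffeo \<phi>" "P \<in> Pol n"
  shows "is_pdo n (inv_into UNIV \<phi>) (app (symbol_op n \<phi> P))"
  unfolding is_pdo_def
  using app_symbol_op[OF assms] smooth_symbol_coeff[OF assms(2)]
  by (intro exI[of _ "symbol_coeff n P"]) simp

lemma diffeo_comp_inv:
  assumes "diffeo \<phi>1" "diffeo \<phi>2"
  shows "inv_into UNIV (\<phi>1 \<circ> \<phi>2) = inv_into UNIV \<phi>2 \<circ> inv_into UNIV \<phi>1"
  using assms unfolding diffeo_def by (simp add: o_inv_distrib)

text \<open>That the composite is a diffeomorphism is taken as a premise: in the application it is
  the diffeomorphism of a product of group elements.\<close>

lemma symbol_op_mult: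
  assumes "diffeo \<phi>1" "diffeo \<phi>2" "diffeo (\<phi>1 \<circ> \<phi>2)" "P \<in> Pol m" "Q \<in> Pol n"
  shows "\<exists>R\<in>Pol (m + n). symbol_op m \<phi>1 P * symbol_op n \<phi>2 Q = symbol_op (m + n) (\<phi>1 \<circ> \<phi>2) R"
proof -
  have "is_pdo (m + n) (inv_into UNIV (\<phi>1 \<circ> \<phi>2)) (app (symbol_op m \<phi>1 P * symbol_op n \<phi>2 Q))"
    unfolding diffeo_comp_inv[OF assms(1,2)]
    using is_pdo_comp[OF is_pdo_symbol_op[OF assms(1,4)] is_pdo_symbol_op[OF assms(2,5)]
        diffeo_smooth_inv[OF assms(1)] diffeo_smooth_inv[OF assms(2)]]
    by (rule is_pdo_cong) (simp add: app_times)
  from symbol_op_surj[OF assms(3) this] show ?thesis by blast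
qed

lemma constant_symbol: "(\<lambda>x \<xi>. 1) = symbol_of 0 (\<lambda>\<alpha> x. 1)"
proof -
  have "{\<alpha> :: 'a multi_index. mi_size \<alpha> \<le> 0} = {\<lambda>i. 0}"
    by (auto simp: mi_size_def)
  then show ?thesis by (simp add: symbol_of_def monomial_def fun_eq_iff)
qed

lemma Pol_one: "(\<lambda>x \<xi>. 1) \<in> Pol 0"
  unfolding constant_symbol by (rule symbol_of_in_Pol) simp

lemma diffeo_id: "diffeo (id :: real^'d::finite \<Rightarrow> real^'d)"
proof -
  have "smooth (id :: real^'d \<Rightarrow> real^'d)"
    unfolding smooth_def id_def
  proof
    fix r show "times_cont_diff r (\<lambda>x :: real^'d. x)"
      using smooth_const[unfolded smooth_def] by (cases r) auto
  qed
  then show ?thesis by (simp add: diffeo_def)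
qed

lemma symbol_op_one: "symbol_op 0 id (\<lambda>x \<xi>. 1) = 1"
proof (rule smooth_op_eqI)
  fix \<psi> :: "real^'a \<Rightarrow> complex" assume \<psi>: "smooth \<psi>"
  have "{\<alpha> :: 'a multi_index. mi_size \<alpha> \<le> 0} = {\<lambda>i. 0}"
    by (auto simp: mi_size_def)
  moreover have "foldr (\<lambda>i. partial i ^^ 0) js \<psi> = \<psi>" for js
    by (induction js) auto
  ultimately show "app (symbol_op 0 id (\<lambda>x \<xi>. 1)) \<psi> = app 1 \<psi>"
    unfolding constant_symbol using \<psi>
    by (simp add: app_symbol_op_symbol_of diffeo_id app_one symbol_pdo_def Dop_def partials_def
      mi_size_def)
qed

section \<open>Deformations in a filtered ring\<close>

text \<open>Dependent choice in which stage \<open>n\<close> freezes the values up to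
  \<open>r n\<close>. The diagonal sequence agrees with stage \<open>n\<close> on that range, and
  \<open>local\<close> says that \<open>P n\<close> looks no further.\<close>

lemma history_choice:
  fixes P :: "nat \<Rightarrow> (nat \<Rightarrow> 'a) \<Rightarrow> bool"
  assumes base: "P 0 x0"
    and step: "\<And>n x. P n x \<Longrightarrow> \<exists>y. (\<forall>m\<le>r n. y m = x m) \<and> P (Suc n) y"
    and local: "\<And>n x y. P n x \<Longrightarrow> (\<And>m. m \<le> r n \<Longrightarrow> y m = x m) \<Longrightarrow> P n y"
    and r: "\<And>n. n \<le> r n" "mono r"
  shows "\<exists>x. \<forall>n. P n x"
proof -
  have "\<exists>s. \<forall>n. P n (s n) \<and> (\<forall>m\<le>r n. s (Suc n) m = s n m)"
    by (rule dependent_nat_choice) (use base step in blast)+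
  then obtain s where s: "\<And>n. P n (s n)" "\<And>n m. m \<le> r n \<Longrightarrow> s (Suc n) m = s n m"
    by blast
  have later: "s (n + k) m = s n m" if "m \<le> r n" for n k m
  proof (induction k)
    case (Suc k)
    then show ?case using s(2)[of m "n + k"] that monoD[OF r(2), of n "n + k"] by simp
  qed simp
  \<comment> \<open>If \<open>n \<le> m\<close>, stage \<open>m\<close> still keeps the values
    frozen at stage \<open>n\<close>; otherwise stage \<open>n\<close> keeps the value at
    \<open>m\<close> frozen at stage \<open>m\<close>, because \<open>m \<le> r m\<close>.\<close>
  have "s m m = s n m" if "m \<le> r n" for n m
    using later[OF that, of "m - n"] later[OF r(1), of m "n - m"] by (cases "n \<le> m") auto
  then have "P n (\<lambda>m. s m m)" for n
    by (intro local[OF s(1)])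
  then show ?thesis by blast
qed

text \<open>At the leading order of \<open>F\<close> only the constant coefficient of
  \<open>A\<close> counts. This is why the differential is twisted by \<open>A0\<close> alone and
  not by the full solution.\<close>

lemma fps_mult_nth_leading_right:
  fixes A F :: "'r::ring_1 fps"
  assumes "\<And>i. i < N \<Longrightarrow> fps_nth F i = 0"
  shows "fps_nth (A * F) N = fps_nth A 0 * fps_nth F N"
proof -
  have "fps_nth (A * F) N = (\<Sum>i\<in>{0..N}. if i = 0 then fps_nth A 0 * fps_nth F N else 0)"
    unfolding fps_mult_nth using assms by (intro sum.cong) auto
  then show ?thesis by simp
qed

lemma fps_mult_nth_leading_left:
  fixes A F :: "'r::ring_1 fps"
  assumes "\<And>i. i < N \<Longrightarrow> fps_nth F i = 0"
  shows "fps_nth (F * A) N = fps_nth F N * fps_nth A 0"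
proof -
  have "fps_nth (F * A) N = (\<Sum>i\<in>{0..N}. if i = N then fps_nth F N * fps_nth A 0 else 0)"
    unfolding fps_mult_nth using assms by (intro sum.cong) auto
  then show ?thesis by simp
qed

text \<open>Isolates the two products that contain a coefficient of index \<open>N\<close>, the
  unknown of the step at order \<open>N\<close>; the remaining sum involves only coefficients of
  index strictly between 0 and \<open>N\<close>.\<close>

lemma fps_mult_nth_split:
  fixes A B :: "'r::ring_1 fps"
  assumes "N > 0"
  shows "fps_nth (A * B) N = fps_nth A 0 * fps_nth B N + fps_nth A N * fps_nth B 0
    + (\<Sum>i\<in>{0<..<N}. fps_nth A i * fps_nth B (N - i))"
proof -
  have "{0..N} = insert 0 (insert N {0<..<N})" using assms by auto
  then show ?thesis unfolding fps_mult_nth using assms by (simp add: add.assoc)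
qed

lemma fps_mult_nth_cong:
  assumes "\<And>m. m \<le> n \<Longrightarrow> fps_nth A m = fps_nth A' m" "\<And>m. m \<le> n \<Longrightarrow> fps_nth B m = fps_nth B' m"
  shows "fps_nth (A * B) n = fps_nth (A' * B') n"
  unfolding fps_mult_nth using assms by (intro sum.cong) auto

text \<open>\<open>M n g\<close> plays the role of the differential operators of order at most \<open>n\<close> over the diffeomorphism
  \<open>\<phi> g\<close>.\<close>

locale filtered_representation = group G for G (structure) +
  fixes M :: "nat \<Rightarrow> 'a \<Rightarrow> 'r::ring_1 set" and A0 :: "'a \<Rightarrow> 'r"
  assumes M_zero: "g \<in> carrier G \<Longrightarrow> 0 \<in> M n g"
    and M_add: "g \<in> carrier G \<Longrightarrow> a \<in> M n g \<Longrightarrow> b \<in> M n g \<Longrightarrow> a + b \<in> M n g"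
    and M_uminus: "g \<in> carrier G \<Longrightarrow> a \<in> M n g \<Longrightarrow> - a \<in> M n g"
    and M_mult: "g \<in> carrier G \<Longrightarrow> h \<in> carrier G \<Longrightarrow> a \<in> M m g \<Longrightarrow> b \<in> M n h \<Longrightarrow>
      a * b \<in> M (m + n) (g \<otimes> h)"
    and M_one: "1 \<in> M 0 \<one>"
    and A0: "g \<in> carrier G \<Longrightarrow> A0 g \<in> M 0 g"
    and A0_mult: "g \<in> carrier G \<Longrightarrow> h \<in> carrier G \<Longrightarrow> A0 g * A0 h = A0 (g \<otimes> h)"
begin

lemma M_sum: "g \<in> carrier G \<Longrightarrow> (\<And>i. i \<in> I \<Longrightarrow> a i \<in> M n g) \<Longrightarrow> sum a I \<in> M n g"
  by (induction I rule: infinite_finite_induct) (auto intro: M_zero M_add)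

lemma M_fps_mult:
  assumes "g \<in> carrier G" "h \<in> carrier G"
    and "\<And>n. fps_nth A n \<in> M n g" "\<And>n. fps_nth B n \<in> M n h"
  shows "fps_nth (A * B) n \<in> M n (g \<otimes> h)"
  unfolding fps_mult_nth
proof (rule M_sum)
  fix i assume "i \<in> {0..n}"
  then show "fps_nth A i * fps_nth B (n - i) \<in> M n (g \<otimes> h)"
    using M_mult[OF assms(1,2) assms(3)[of i] assms(4)[of "n - i"]] by simp
qed (use assms in simp)

text \<open>The twisted differential in degree one, read through operators;
  \<open>coboundary2\<close> is its analogue in degree two. They are the differentials of group
  cohomology with \<open>A0\<close> acting from the left and from the right.\<close>

definition coboundary1 :: "('a \<Rightarrow> 'r) \<Rightarrow> 'a \<Rightarrow> 'a \<Rightarrow> 'r"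
  where "coboundary1 b g h = A0 g * b h + b g * A0 h - b (g \<otimes> h)"

definition coboundary2 :: "('a \<Rightarrow> 'a \<Rightarrow> 'r) \<Rightarrow> 'a \<Rightarrow> 'a \<Rightarrow> 'a \<Rightarrow> 'r"
  where "coboundary2 c g h k = A0 g * c h k - c (g \<otimes> h) k + c g (h \<otimes> k) - c g h * A0 k"

text \<open>Exactness for families of operators, without forming a quotient. A cochain of degree 0
  is a single operator over the identity, hence \<open>M n \<one>\<close>.\<close>

definition H1_vanishes :: "nat \<Rightarrow> bool"
  where "H1_vanishes n \<longleftrightarrow> (\<forall>c.
    (\<forall>g\<in>carrier G. c g \<in> M n g) \<longrightarrow>
    (\<forall>g\<in>carrier G. \<forall>h\<in>carrier G. coboundary1 c g h = 0) \<longrightarrow>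
    (\<exists>b\<in>M n \<one>. \<forall>g\<in>carrier G. c g = A0 g * b - b * A0 g))"

definition H2_vanishes :: "nat \<Rightarrow> bool"
  where "H2_vanishes n \<longleftrightarrow> (\<forall>c.
    (\<forall>g\<in>carrier G. \<forall>h\<in>carrier G. c g h \<in> M n (g \<otimes> h)) \<longrightarrow>
    (\<forall>g\<in>carrier G. \<forall>h\<in>carrier G. \<forall>k\<in>carrier G. coboundary2 c g h k = 0) \<longrightarrow>
    (\<exists>b. (\<forall>g\<in>carrier G. b g \<in> M n g) \<and>
      (\<forall>g\<in>carrier G. \<forall>h\<in>carrier G. c g h = coboundary1 b g h)))"

text \<open>The Bianchi identity.\<close>

lemma curvature_cocycle:
  fixes A :: "'a \<Rightarrow> 'r fps"
  assumes lead: "\<And>g. g \<in> carrier G \<Longrightarrow> fps_nth (A g) 0 = A0 g"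
    and low: "\<And>g h i. g \<in> carrier G \<Longrightarrow> h \<in> carrier G \<Longrightarrow> i < N \<Longrightarrow>
      fps_nth (A g * A h - A (g \<otimes> h)) i = 0"
    and G: "g \<in> carrier G" "h \<in> carrier G" "k \<in> carrier G"
  shows "coboundary2 (\<lambda>g h. fps_nth (A g * A h - A (g \<otimes> h)) N) g h k = 0"
proof -
  define F where "F g h = A g * A h - A (g \<otimes> h)" for g h
  \<comment> \<open>By associativity all products cancel in pairs.\<close>
  have "A g * F h k - F (g \<otimes> h) k + F g (h \<otimes> k) - F g h * A k = 0"
    by (simp add: F_def algebra_simps m_assoc G)
  then have "fps_nth (A g * F h k - F (g \<otimes> h) k + F g (h \<otimes> k) - F g h * A k) N = 0"
    by simp
  \<comment> \<open>At order \<open>N\<close> the outer factors \<open>A g\<close> and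
    \<open>A k\<close> contribute only their constant coefficients, as \<open>F\<close> vanishes
    below \<open>N\<close>.\<close>
  then show ?thesis
    using fps_mult_nth_leading_right[of N "F h k" "A g"] fps_mult_nth_leading_left[of N "F g h" "A k"]
      low lead G by (simp add: coboundary2_def F_def)
qed

text \<open>The order is the first argument of \<open>a\<close>, so that \<open>a(N := b)\<close>
  replaces one order for all group elements at once.\<close>

definition series :: "(nat \<Rightarrow> 'a \<Rightarrow> 'r) \<Rightarrow> 'a \<Rightarrow> 'r fps"
  where "series a g = Abs_fps (\<lambda>n. a n g)"

lemma series_nth [simp]: "fps_nth (series a g) n = a n g"
  by (simp add: series_def)

text \<open>One step of obstruction theory: the defect at order \<open>N\<close> of the truncated
  solution is a two-cocycle, and a primitive of it, with the sign changed, is the missing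
  coefficient.\<close>

lemma extend_solution:
  assumes H2: "H2_vanishes N" and N: "N > 0"
    and lead: "\<And>g. g \<in> carrier G \<Longrightarrow> a 0 g = A0 g"
    and a: "\<And>g n. g \<in> carrier G \<Longrightarrow> n < N \<Longrightarrow> a n g \<in> M n g"
    and low: "\<And>g h n. g \<in> carrier G \<Longrightarrow> h \<in> carrier G \<Longrightarrow> n < N \<Longrightarrow>
      fps_nth (series a g * series a h) n = a n (g \<otimes> h)"
  shows "\<exists>b. (\<forall>g\<in>carrier G. b g \<in> M N g) \<and> (\<forall>g\<in>carrier G. \<forall>h\<in>carrier G.
    fps_nth (series (a(N := b)) g * series (a(N := b)) h) N = b (g \<otimes> h))"
proof -
  \<comment> \<open>The truncation has coefficient 0 at order \<open>N\<close>, so \<open>c\<close>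
    is just the sum of the products of lower coefficients.\<close>
  define A where "A g = Abs_fps (\<lambda>n. if n < N then a n g else 0)" for g
  define c where "c g h = fps_nth (A g * A h - A (g \<otimes> h)) N" for g h
  have A: "fps_nth (A g) n \<in> M n g" if "g \<in> carrier G" for g n
    using a M_zero that by (simp add: A_def)
  have A_low: "fps_nth (A g * A h) n = fps_nth (A (g \<otimes> h)) n"
    if "g \<in> carrier G" "h \<in> carrier G" "n < N" for g h n
  proof -
    have "fps_nth (A g * A h) n = fps_nth (series a g * series a h) n"
      using that by (intro fps_mult_nth_cong) (auto simp: A_def)
    then show ?thesis using low that by (simp add: A_def)
  qed
  have "c g h \<in> M N (g \<otimes> h)" if "g \<in> carrier G" "h \<in> carrier G" for g h
    using M_fps_mult[OF that A[OF that(1)] A[OF that(2)]] by (simp add: c_def A_def)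
  moreover have "coboundary2 c g h k = 0"
    if "g \<in> carrier G" "h \<in> carrier G" "k \<in> carrier G" for g h k
    unfolding c_def by (rule curvature_cocycle) (use A_low that lead N in \<open>simp_all add: A_def\<close>)
  ultimately obtain b where b: "\<And>g. g \<in> carrier G \<Longrightarrow> b g \<in> M N g"
    "\<And>g h. g \<in> carrier G \<Longrightarrow> h \<in> carrier G \<Longrightarrow> c g h = coboundary1 b g h"
    using H2 unfolding H2_vanishes_def by metis
  \<comment> \<open>Inserting \<open>- b\<close> changes the defect at order \<open>N\<close> by
    \<open>- coboundary1 b\<close>, which cancels \<open>c\<close>.\<close>
  let ?a = "a(N := \<lambda>g. - b g)"
  have "fps_nth (series ?a g * series ?a h) N = - b (g \<otimes> h)"
    if G: "g \<in> carrier G" "h \<in> carrier G" for g h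
  proof -
    have "fps_nth (A g * A h) N = (\<Sum>i\<in>{0<..<N}. a i g * a (N - i) h)"
      unfolding fps_mult_nth_split[OF N] using N by (simp add: A_def)
    moreover have "fps_nth (series ?a g * series ?a h) N
        = - A0 g * b h - b g * A0 h + (\<Sum>i\<in>{0<..<N}. a i g * a (N - i) h)"
      unfolding fps_mult_nth_split[OF N] using N lead G by (auto intro!: sum.cong)
    ultimately show ?thesis
      using b(2)[OF G] by (simp add: c_def A_def coboundary1_def)
  qed
  then show ?thesis using b(1) M_uminus by (intro exI[of _ "\<lambda>g. - b g"]) auto
qed

theorem solution_exists:
  assumes H2: "\<And>n. n \<ge> 2 \<Longrightarrow> H2_vanishes n"
    and A1: "\<And>g. g \<in> carrier G \<Longrightarrow> A1 g \<in> M 1 g"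
    and cocycle: "\<And>g h. g \<in> carrier G \<Longrightarrow> h \<in> carrier G \<Longrightarrow> coboundary1 A1 g h = 0"
  shows "\<exists>A. (\<forall>g\<in>carrier G. (\<forall>n. fps_nth (A g) n \<in> M n g) \<and>
      fps_nth (A g) 0 = A0 g \<and> fps_nth (A g) 1 = A1 g) \<and>
    (\<forall>g\<in>carrier G. \<forall>h\<in>carrier G. A g * A h = A (g \<otimes> h))"
proof -
  \<comment> \<open>Stage \<open>N\<close> is correct through order \<open>Suc N\<close>, as the
    orders 0 and 1 are given. The first extension is therefore at order 2.\<close>
  define P where "P N a \<longleftrightarrow> a 0 = A0 \<and> a 1 = A1 \<and>
    (\<forall>g\<in>carrier G. \<forall>n\<le>Suc N. a n g \<in> M n g) \<and>
    (\<forall>g\<in>carrier G. \<forall>h\<in>carrier G. \<forall>n\<le>Suc N.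
      fps_nth (series a g * series a h) n = a n (g \<otimes> h))" for N a
  have "\<exists>a. (\<forall>N. P N a)"
  proof -
    \<comment> \<open>Values at orders above 1 are placeholders that \<open>P 0\<close> does not
      see. In \<open>P 0\<close> itself, order 0 is the multiplicativity of \<open>A0\<close> and
      order 1 is the cocycle condition on \<open>A1\<close>.\<close>
    define a where "a n = (if n = 0 then A0 else A1)" for n :: nat
    have "P 0 a"
      using A0 A1 A0_mult cocycle
      by (auto simp: P_def a_def le_Suc_eq fps_mult_nth coboundary1_def)
    moreover have "\<exists>a'. (\<forall>n\<le>Suc N. a' n = a n) \<and> P (Suc N) a'" if "P N a" for N a
    proof -
      have "\<exists>b. (\<forall>g\<in>carrier G. b g \<in> M (Suc (Suc N)) g) \<and> (\<forall>g\<in>carrier G. \<forall>h\<in>carrier G.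
        fps_nth (series (a(Suc (Suc N) := b)) g * series (a(Suc (Suc N) := b)) h) (Suc (Suc N))
          = b (g \<otimes> h))"
        using that by (intro extend_solution H2) (auto simp: P_def less_Suc_eq_le)
      then obtain b where b: "\<And>g. g \<in> carrier G \<Longrightarrow> b g \<in> M (Suc (Suc N)) g"
        "\<And>g h. g \<in> carrier G \<Longrightarrow> h \<in> carrier G \<Longrightarrow>
          fps_nth (series (a(Suc (Suc N) := b)) g * series (a(Suc (Suc N) := b)) h) (Suc (Suc N))
            = b (g \<otimes> h)"
        by blast
      let ?a = "a(Suc (Suc N) := b)"
      have "fps_nth (series ?a g * series ?a h) n = fps_nth (series a g * series a h) n"
        if "n \<le> Suc N" for n g h
        using that by (intro fps_mult_nth_cong) auto
      then have "P (Suc N) ?a" using that b unfolding P_def by (auto simp: le_Suc_eq[of _ "Suc N"])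
      then show ?thesis by (intro exI[of _ ?a]) auto
    qed
    moreover have "P N a'" if "P N a" "\<And>m. m \<le> Suc N \<Longrightarrow> a' m = a m" for N a a'
    proof -
      have "fps_nth (series a' g * series a' h) n = fps_nth (series a g * series a h) n"
        if "n \<le> Suc N" for n g h
        using that \<open>\<And>m. m \<le> Suc N \<Longrightarrow> a' m = a m\<close> by (intro fps_mult_nth_cong) auto
      then show ?thesis using that unfolding P_def by auto
    qed
    ultimately show ?thesis by (rule history_choice[of P a Suc]) (auto simp: mono_def)
  qed
  then obtain a where a: "\<And>N. P N a" by blast
  show ?thesis
  proof (intro exI[of _ "series a"] conjI ballI allI)
    fix g h assume G: "g \<in> carrier G" "h \<in> carrier G"
    show "series a g * series a h = series a (g \<otimes> h)"
    proof (rule fps_ext)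
      fix n show "fps_nth (series a g * series a h) n = fps_nth (series a (g \<otimes> h)) n"
        using a[of n] G by (simp add: P_def)
    qed
  next
    fix g n assume "g \<in> carrier G"
    then show "fps_nth (series a g) n \<in> M n g" using a[of n] by (simp add: P_def)
  qed (use a in \<open>auto simp: P_def\<close>)
qed

text \<open>The degree-one counterpart of \<open>extend_solution\<close>: the failure
  \<open>E\<close> of the truncated \<open>U\<close> to intertwine \<open>A\<close> with
  \<open>A0\<close> has a one-cocycle as its coefficient at order \<open>N\<close>.\<close>

lemma extend_gauge:
  assumes H1: "H1_vanishes N" and N: "N > 0"
    and A: "\<And>g n. g \<in> carrier G \<Longrightarrow> fps_nth (A g) n \<in> M n g"
    and lead: "\<And>g. g \<in> carrier G \<Longrightarrow> fps_nth (A g) 0 = A0 g"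
    and A_mult: "\<And>g h. g \<in> carrier G \<Longrightarrow> h \<in> carrier G \<Longrightarrow> A g * A h = A (g \<otimes> h)"
    and u: "\<And>n. n < N \<Longrightarrow> u n \<in> M n \<one>"
    and low: "\<And>g n. g \<in> carrier G \<Longrightarrow> n < N \<Longrightarrow> fps_nth (A g * Abs_fps u) n = u n * A0 g"
  shows "\<exists>b\<in>M N \<one>. \<forall>g\<in>carrier G. fps_nth (A g * Abs_fps (u(N := b))) N = b * A0 g"
proof -
  define U where "U = Abs_fps (\<lambda>n. if n < N then u n else 0)"
  define E where "E g = A g * U - U * fps_const (A0 g)" for g
  have U: "fps_nth U n \<in> M n \<one>" for n
    using u M_zero by (simp add: U_def)
  have E_low: "fps_nth (E g) n = 0" if "g \<in> carrier G" "n < N" for g n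
  proof -
    have "fps_nth (A g * U) n = fps_nth (A g * Abs_fps u) n"
      using that by (intro fps_mult_nth_cong) (auto simp: U_def)
    then show ?thesis using low that by (simp add: E_def U_def)
  qed
  define c where "c g = fps_nth (E g) N" for g
  \<comment> \<open>\<open>U\<close> has no coefficient at order \<open>N\<close>, so
    \<open>U * fps_const (A0 g)\<close> drops out.\<close>
  have c: "c g = fps_nth (A g * U) N" for g by (simp add: c_def E_def U_def)
  have "c g \<in> M N g" if "g \<in> carrier G" for g
    using M_fps_mult[OF that one_closed A[OF that] U] that by (simp add: c)
  moreover have "coboundary1 c g h = 0" if G: "g \<in> carrier G" "h \<in> carrier G" for g h
  proof -
    \<comment> \<open>The mixed terms \<open>A g * U * fps_const (A0 h)\<close> cancel; what is left
      measures the multiplicativity of \<open>A\<close> and of \<open>A0\<close>, both of which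
      hold.\<close>
    have "A g * E h + E g * fps_const (A0 h) - E (g \<otimes> h) =
        (A g * A h - A (g \<otimes> h)) * U - U * (fps_const (A0 g) * fps_const (A0 h) - fps_const (A0 (g \<otimes> h)))"
      by (simp add: E_def algebra_simps del: fps_const_mult)
    also have "\<dots> = 0" using A_mult[OF G] A0_mult[OF G] by simp
    finally have "fps_nth (A g * E h + E g * fps_const (A0 h) - E (g \<otimes> h)) N = 0" by simp
    then show ?thesis
      using fps_mult_nth_leading_right[of N "E h" "A g"] E_low G lead
      by (simp add: coboundary1_def c_def)
  qed
  ultimately obtain b where b: "b \<in> M N \<one>" "\<And>g. g \<in> carrier G \<Longrightarrow> c g = A0 g * b - b * A0 g"
    using H1 unfolding H1_vanishes_def by metis
  have "fps_nth (A g * Abs_fps (u(N := - b))) N = - b * A0 g" if "g \<in> carrier G" for g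
  proof -
    have "c g = fps_nth (A g) N * u 0 + (\<Sum>i\<in>{0<..<N}. fps_nth (A g) i * u (N - i))"
      unfolding c fps_mult_nth_split[OF N] using N by (simp add: U_def)
    moreover have "fps_nth (A g * Abs_fps (u(N := - b))) N = - A0 g * b + fps_nth (A g) N * u 0
        + (\<Sum>i\<in>{0<..<N}. fps_nth (A g) i * u (N - i))"
      unfolding fps_mult_nth_split[OF N] using N lead that by (auto intro!: sum.cong)
    ultimately have "fps_nth (A g * Abs_fps (u(N := - b))) N = c g - A0 g * b" by simp
    then show ?thesis using b(2)[OF that] by simp
  qed
  then show ?thesis using b(1) M_uminus by (intro bexI[of _ "- b"]) auto
qed

theorem gauge_exists:
  assumes H1: "\<And>n. n \<ge> 1 \<Longrightarrow> H1_vanishes n"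
    and A: "\<And>g n. g \<in> carrier G \<Longrightarrow> fps_nth (A g) n \<in> M n g"
    and lead: "\<And>g. g \<in> carrier G \<Longrightarrow> fps_nth (A g) 0 = A0 g"
    and A_mult: "\<And>g h. g \<in> carrier G \<Longrightarrow> h \<in> carrier G \<Longrightarrow> A g * A h = A (g \<otimes> h)"
  shows "\<exists>U. (\<forall>n. fps_nth U n \<in> M n \<one>) \<and> fps_nth U 0 = 1 \<and>
    (\<forall>g\<in>carrier G. A g * U = U * fps_const (A0 g))"
proof -
  define P where "P N u \<longleftrightarrow> u 0 = 1 \<and> (\<forall>n\<le>N. u n \<in> M n \<one>) \<and>
    (\<forall>g\<in>carrier G. \<forall>n\<le>N. fps_nth (A g * Abs_fps u) n = u n * A0 g)" for N and u :: "nat \<Rightarrow> 'r"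
  have "\<exists>u. (\<forall>N. P N u)"
  proof -
    \<comment> \<open>The constant coefficient 1 intertwines at order 0 because \<open>A\<close> and
      \<open>A0\<close> agree there, so corrections start at order 1. Later entries are
      placeholders.\<close>
    have "P 0 (\<lambda>n. 1)"
      using M_one lead by (simp add: P_def)
    moreover have "\<exists>v. (\<forall>n\<le>N. v n = u n) \<and> P (Suc N) v" if "P N u" for N u
    proof -
      have "\<exists>b\<in>M (Suc N) \<one>. \<forall>g\<in>carrier G. fps_nth (A g * Abs_fps (u(Suc N := b))) (Suc N) = b * A0 g"
        using that by (intro extend_gauge H1 A lead A_mult) (auto simp: P_def less_Suc_eq_le)
      then obtain b where b: "b \<in> M (Suc N) \<one>"
        "\<And>g. g \<in> carrier G \<Longrightarrow> fps_nth (A g * Abs_fps (u(Suc N := b))) (Suc N) = b * A0 g"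
        by blast
      have "fps_nth (A g * Abs_fps (u(Suc N := b))) n = fps_nth (A g * Abs_fps u) n"
        if "n \<le> N" for n g
        using that by (intro fps_mult_nth_cong) auto
      then have "P (Suc N) (u(Suc N := b))" using that b unfolding P_def by (auto simp: le_Suc_eq)
      then show ?thesis by (intro exI[of _ "u(Suc N := b)"]) auto
    qed
    moreover have "P N v" if "P N u" "\<And>m. m \<le> N \<Longrightarrow> v m = u m" for N u v
    proof -
      have "fps_nth (A g * Abs_fps v) n = fps_nth (A g * Abs_fps u) n" if "n \<le> N" for n g
        using that \<open>\<And>m. m \<le> N \<Longrightarrow> v m = u m\<close> by (intro fps_mult_nth_cong) auto
      then show ?thesis using that unfolding P_def by auto
    qed
    ultimately show ?thesis
      by (rule history_choice[of P "\<lambda>n. 1" "\<lambda>n. n"]) (auto simp: mono_def)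
  qed
  then obtain u where u: "\<And>N. P N u" by blast
  show ?thesis
  proof (intro exI[of _ "Abs_fps u"] conjI ballI allI)
    fix g assume G: "g \<in> carrier G"
    show "A g * Abs_fps u = Abs_fps u * fps_const (A0 g)"
    proof (rule fps_ext)
      fix n show "fps_nth (A g * Abs_fps u) n = fps_nth (Abs_fps u * fps_const (A0 g)) n"
        using u[of n] G by (simp add: P_def)
    qed
  next
    fix n show "fps_nth (Abs_fps u) n \<in> M n \<one>" using u[of n] by (simp add: P_def)
  qed (use u in \<open>auto simp: P_def\<close>)
qed

text \<open>Invertibility in the power series ring is not enough: the inverse must come from
  symbols. Its recursion expresses coefficient \<open>n\<close> by products whose orders add up to
  \<open>n\<close>, so the filtration is respected.\<close>

lemma inverse_exists:
  assumes U: "\<And>n. fps_nth U n \<in> M n \<one>" and U0: "fps_nth U 0 = 1"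
  shows "\<exists>V. (\<forall>n. fps_nth V n \<in> M n \<one>) \<and> U * V = 1 \<and> V * U = 1"
proof -
  define V where "V = fps_right_inverse U 1"
  have UV: "U * V = 1" unfolding V_def by (rule fps_right_inverse) (simp add: U0)
  moreover have "V * U = 1"
    using fps_left_inverse_eq_fps_right_inverse[of 1 U 1] fps_left_inverse[of 1 U] U0
    by (simp add: V_def)
  moreover have "fps_nth V n \<in> M n \<one>" for n
  proof (induction n rule: less_induct)
    case (less n)
    show ?case
    proof (cases "n = 0")
      case True
      then show ?thesis using M_one by (simp add: V_def)
    next
      case False
      have "fps_nth (U * V) n = 0" using UV False by simp
      then have "fps_nth V n = - (\<Sum>i=1..n. fps_nth U i * fps_nth V (n - i))"
        unfolding fps_mult_nth using U0
        by (simp add: sum.atLeast_Suc_atMost eq_neg_iff_add_eq_0)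
      moreover have "fps_nth U i * fps_nth V (n - i) \<in> M n \<one>" if "i \<in> {1..n}" for i
        using M_mult[OF one_closed one_closed U less[of "n - i"], of i] that by simp
      ultimately show ?thesis by (simp only:) (rule M_uminus[OF one_closed M_sum[OF one_closed]])
    qed
  qed
  ultimately show ?thesis by blast
qed

end

section \<open>The star product as multiplication of power series\<close>

definition symbol_series ::
    "(real^'d \<Rightarrow> real^'d) \<Rightarrow> 'd formal_symbol \<Rightarrow> ('d::finite) smooth_op fps"
  where "symbol_series \<phi> P = Abs_fps (\<lambda>n. symbol_op n \<phi> (P n))"

lemma symbol_series_nth [simp]: "fps_nth (symbol_series \<phi> P) n = symbol_op n \<phi> (P n)"
  by (simp add: symbol_series_def)

text \<open>The Cauchy product action of operator series on formal functions; \<open>Op1\<close> is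
  its restriction to series that come from symbols.\<close>

definition fps_apply :: "('d::finite) smooth_op fps \<Rightarrow> 'd formal_function \<Rightarrow> 'd formal_function"
  where "fps_apply A \<psi> = (\<lambda>N x. \<Sum>n\<le>N. app (fps_nth A n) (\<psi> (N - n)) x)"

lemma Op1_eq_fps_apply:
  assumes "diffeo \<phi>" "P \<in> formal_symbols" "\<psi> \<in> formal_functions"
  shows "Op1 P \<phi> \<psi> = fps_apply (symbol_series \<phi> P) \<psi>"
  using assms unfolding Op1_def fps_apply_def
  by (simp add: app_symbol_op formal_symbols_def formal_functions_def symbol_pdo_def)

lemma fps_apply_formal_functions: "\<psi> \<in> formal_functions \<Longrightarrow> fps_apply A \<psi> \<in> formal_functions"
  unfolding formal_functions_def fps_apply_def by (auto intro!: smooth_sum smooth_app)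

text \<open>Both sides sum over the pairs (i, j) with i + j at most \<open>N\<close>, grouped by
  total order or by \<open>i\<close>; additivity of the operators splits the inner
  application.\<close>

lemma fps_apply_mult:
  assumes "\<psi> \<in> formal_functions"
  shows "fps_apply (A * B) \<psi> = fps_apply A (fps_apply B \<psi>)"
proof (intro ext)
  fix N x
  have \<psi>: "smooth (\<psi> n)" for n using assms by (simp add: formal_functions_def)
  let ?t = "\<lambda>i j. app (fps_nth A i) (app (fps_nth B j) (\<psi> (N - (i + j)))) x"
  have "fps_apply (A * B) \<psi> N x = (\<Sum>n\<le>N. \<Sum>i\<le>n. ?t i (n - i))"
    unfolding fps_apply_def fps_mult_nth app_op_sum app_times
    by (intro sum.cong) (auto simp: atMost_atLeast0)
  also have "\<dots> = (\<Sum>(i, j) | i + j \<le> N. ?t i j)"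
    by (rule sum.triangle_reindex_eq[symmetric])
  also have "{(i, j). i + j \<le> N} = Sigma {..N} (\<lambda>i. {..N - i})" by auto
  also have "(\<Sum>(i, j) \<in> Sigma {..N} (\<lambda>i. {..N - i}). ?t i j) = (\<Sum>i\<le>N. \<Sum>j\<le>N - i. ?t i j)"
    by (rule sum.Sigma[symmetric]) auto
  also have "\<dots> = fps_apply A (fps_apply B \<psi>) N x"
    unfolding fps_apply_def by (simp add: app_sum smooth_app \<psi>)
  finally show "fps_apply (A * B) \<psi> N x = fps_apply A (fps_apply B \<psi>) N x" .
qed

lemma fps_apply_inject:
  assumes "\<And>\<psi>. \<psi> \<in> formal_functions \<Longrightarrow> fps_apply A \<psi> = fps_apply B \<psi>"
  shows "A = B"
proof (rule fps_ext, rule smooth_op_eqI, rule ext)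
  fix n and \<theta> :: "real^'a \<Rightarrow> complex" and x
  assume \<theta>: "smooth \<theta>"
  \<comment> \<open>A function concentrated in order 0: order \<open>n\<close> of the result is then
    the coefficient \<open>n\<close> of the series applied to \<theta>.\<close>
  define \<psi> where "\<psi> k = (if k = 0 then \<theta> else 0)" for k :: nat
  have const: "fps_apply C \<psi> n x = app (fps_nth C n) \<theta> x" for C
  proof -
    have "fps_apply C \<psi> n x = (\<Sum>k\<le>n. if k = n then app (fps_nth C n) \<theta> x else 0)"
      unfolding fps_apply_def by (intro sum.cong) (auto simp: \<psi>_def app_zero simp flip: zero_fun_def)
    then show ?thesis by simp
  qed
  have "\<psi> \<in> formal_functions" using \<theta> by (simp add: formal_functions_def \<psi>_def)
  then show "app (fps_nth A n) \<theta> x = app (fps_nth B n) \<theta> x"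
    using assms const by metis
qed

lemma symbol_series_inject:
  assumes "diffeo \<phi>" "P \<in> formal_symbols" "Q \<in> formal_symbols"
    and "symbol_series \<phi> P = symbol_series \<phi> Q"
  shows "P = Q"
proof
  fix n
  have "symbol_op n \<phi> (P n) = symbol_op n \<phi> (Q n)"
    using arg_cong[OF assms(4), of "\<lambda>A. fps_nth A n"] by simp
  then show "P n = Q n"
    using assms symbol_op_inject unfolding formal_symbols_def by blast
qed

text \<open>The concrete instance of the abstract filtration \<open>M\<close>.\<close>

definition ops :: "nat \<Rightarrow> (real^'d \<Rightarrow> real^'d) \<Rightarrow> ('d::finite) smooth_op set"
  where "ops n \<phi> = symbol_op n \<phi> ` Pol n"

lemma ops_zero: "diffeo \<phi> \<Longrightarrow> 0 \<in> ops n \<phi>"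
  unfolding ops_def using Pol_zero symbol_op_zero by (metis imageI)

lemma ops_add: "diffeo \<phi> \<Longrightarrow> a \<in> ops n \<phi> \<Longrightarrow> b \<in> ops n \<phi> \<Longrightarrow> a + b \<in> ops n \<phi>"
  unfolding ops_def by (auto simp: symbol_op_add[symmetric] intro!: imageI Pol_add)

lemma ops_uminus: "diffeo \<phi> \<Longrightarrow> a \<in> ops n \<phi> \<Longrightarrow> - a \<in> ops n \<phi>"
  unfolding ops_def by (auto simp: symbol_op_uminus[symmetric] intro!: imageI Pol_uminus)

lemma ops_mult:
  assumes "diffeo \<phi>1" "diffeo \<phi>2" "diffeo (\<phi>1 \<circ> \<phi>2)" "a \<in> ops m \<phi>1" "b \<in> ops n \<phi>2"
  shows "a * b \<in> ops (m + n) (\<phi>1 \<circ> \<phi>2)"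
  using assms(4,5) symbol_op_mult[OF assms(1-3)] unfolding ops_def by blast

lemma ops_one: "1 \<in> ops 0 id"
  unfolding ops_def using Pol_one symbol_op_one by (metis imageI)

lemma ops_sum:
  "diffeo \<phi> \<Longrightarrow> (\<And>i. i \<in> I \<Longrightarrow> a i \<in> ops n \<phi>) \<Longrightarrow> sum a I \<in> ops n \<phi>"
  by (induction I rule: infinite_finite_induct) (auto intro: ops_zero ops_add)

lemma symbol_series_surj:
  assumes "\<And>n. fps_nth A n \<in> ops n \<phi>"
  obtains P where "P \<in> formal_symbols" "symbol_series \<phi> P = A"
proof -
  have "\<exists>Q. Q \<in> Pol n \<and> symbol_op n \<phi> Q = fps_nth A n" for n
    using assms[of n] unfolding ops_def by auto
  then obtain P where "\<And>n. P n \<in> Pol n" "\<And>n. symbol_op n \<phi> (P n) = fps_nth A n" by metis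
  then show ?thesis
    using that[of P] by (simp add: formal_symbols_def fps_eq_iff)
qed

text \<open>Resolves the definite description. The product series has its coefficient
  \<open>n\<close> in \<open>ops n\<close>, hence comes from a formal symbol; faithfulness of
  \<open>fps_apply\<close> and of \<open>symbol_series\<close> leaves no second candidate.\<close>

lemma symbol_star:
  assumes \<phi>: "diffeo \<phi>1" "diffeo \<phi>2" "diffeo (\<phi>1 \<circ> \<phi>2)"
    and P: "P \<in> formal_symbols" and K: "K \<in> formal_symbols"
  shows "symbol_star \<phi>1 \<phi>2 P K \<in> formal_symbols"
    and "symbol_series (\<phi>1 \<circ> \<phi>2) (symbol_star \<phi>1 \<phi>2 P K) = symbol_series \<phi>1 P * symbol_series \<phi>2 K"
proof -
  let ?A = "symbol_series \<phi>1 P * symbol_series \<phi>2 K"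
  have "fps_nth ?A n \<in> ops n (\<phi>1 \<circ> \<phi>2)" for n
    unfolding fps_mult_nth
  proof (rule ops_sum[OF \<phi>(3)])
    fix i assume i: "i \<in> {0..n}"
    have "fps_nth (symbol_series \<phi>1 P) i \<in> ops i \<phi>1"
      "fps_nth (symbol_series \<phi>2 K) (n - i) \<in> ops (n - i) \<phi>2"
      using P K by (auto simp: ops_def formal_symbols_def)
    from ops_mult[OF \<phi> this] i
    show "fps_nth (symbol_series \<phi>1 P) i * fps_nth (symbol_series \<phi>2 K) (n - i) \<in> ops n (\<phi>1 \<circ> \<phi>2)"
      by simp
  qed
  then obtain R where R: "R \<in> formal_symbols" "symbol_series (\<phi>1 \<circ> \<phi>2) R = ?A"
    by (rule symbol_series_surj)
  have comp: "Op1 P \<phi>1 (Op1 K \<phi>2 \<psi>) = fps_apply ?A \<psi>" if "\<psi> \<in> formal_functions" for \<psi>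
    using that by (simp add: Op1_eq_fps_apply \<phi> P K fps_apply_formal_functions fps_apply_mult)
  have "symbol_star \<phi>1 \<phi>2 P K = R"
    unfolding symbol_star_def
  proof (rule the_equality)
    show "R \<in> formal_symbols \<and>
      (\<forall>\<psi>\<in>formal_functions. Op1 P \<phi>1 (Op1 K \<phi>2 \<psi>) = Op1 R (\<phi>1 \<circ> \<phi>2) \<psi>)"
      using R by (simp add: comp Op1_eq_fps_apply[OF \<phi>(3)])
  next
    fix R' assume R': "R' \<in> formal_symbols \<and>
      (\<forall>\<psi>\<in>formal_functions. Op1 P \<phi>1 (Op1 K \<phi>2 \<psi>) = Op1 R' (\<phi>1 \<circ> \<phi>2) \<psi>)"
    have "symbol_series (\<phi>1 \<circ> \<phi>2) R' = symbol_series (\<phi>1 \<circ> \<phi>2) R"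
    proof (rule fps_apply_inject)
      fix \<psi> :: "'a formal_function" assume \<psi>: "\<psi> \<in> formal_functions"
      then have "fps_apply ?A \<psi> = fps_apply (symbol_series (\<phi>1 \<circ> \<phi>2) R') \<psi>"
        using R' comp[OF \<psi>] Op1_eq_fps_apply[OF \<phi>(3), of R' \<psi>] by metis
      then show "fps_apply (symbol_series (\<phi>1 \<circ> \<phi>2) R') \<psi> = fps_apply (symbol_series (\<phi>1 \<circ> \<phi>2) R) \<psi>"
        using R(2) by simp
    qed
    then show "R' = R" using symbol_series_inject[OF \<phi>(3)] R' R(1) by blast
  qed
  then show "symbol_star \<phi>1 \<phi>2 P K \<in> formal_symbols"
    and "symbol_series (\<phi>1 \<circ> \<phi>2) (symbol_star \<phi>1 \<phi>2 P K) = ?A"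
    using R by simp_all
qed

lemma symbol_series_add:
  assumes "diffeo \<phi>" "P \<in> formal_symbols" "Q \<in> formal_symbols"
  shows "symbol_series \<phi> (P + Q) = symbol_series \<phi> P + symbol_series \<phi> Q"
  using assms by (simp add: fps_eq_iff formal_symbols_def symbol_op_add)

lemma symbol_series_uminus:
  assumes "diffeo \<phi>" "P \<in> formal_symbols"
  shows "symbol_series \<phi> (- P) = - symbol_series \<phi> P"
  using assms by (simp add: fps_eq_iff formal_symbols_def symbol_op_uminus)

lemma formal_symbols_add: "P \<in> formal_symbols \<Longrightarrow> Q \<in> formal_symbols \<Longrightarrow> P + Q \<in> formal_symbols"
  by (simp add: formal_symbols_def Pol_add)

lemma formal_symbols_uminus: "P \<in> formal_symbols \<Longrightarrow> - P \<in> formal_symbols"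
  by (simp add: formal_symbols_def Pol_uminus)

lemma symbol_series_zero: "diffeo \<phi> \<Longrightarrow> symbol_series \<phi> 0 = 0"
  by (simp add: fps_eq_iff symbol_op_zero)

section \<open>Amplitudes and the differential in low degrees\<close>

lemma tuples_0: "gs \<in> tuples G 0 \<longleftrightarrow> gs = []"
  by (auto simp: tuples_def)

lemma tuples_1: "gs \<in> tuples G 1 \<longleftrightarrow> (\<exists>g\<in>carrier G. gs = [g])"
  by (auto simp: tuples_def length_Suc_conv)

lemma tuples_2: "gs \<in> tuples G 2 \<longleftrightarrow> (\<exists>g\<in>carrier G. \<exists>h\<in>carrier G. gs = [g, h])"
  by (auto simp: tuples_def length_Suc_conv numeral_2_eq_2)

lemma ball_tuples_2:
  "(\<forall>gs\<in>tuples G 2. Q gs) \<longleftrightarrow> (\<forall>g\<in>carrier G. \<forall>h\<in>carrier G. Q [g, h])"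
  by (auto simp: tuples_2)

lemma tuples_3:
  "gs \<in> tuples G 3 \<longleftrightarrow> (\<exists>g\<in>carrier G. \<exists>h\<in>carrier G. \<exists>k\<in>carrier G. gs = [g, h, k])"
  by (auto simp: tuples_def length_Suc_conv numeral_3_eq_3)

lemma amplitudes_add: "a \<in> amplitudes G k \<Longrightarrow> b \<in> amplitudes G k \<Longrightarrow> a + b \<in> amplitudes G k"
  by (simp add: amplitudes_def formal_symbols_add)

lemma amplitudes_uminus: "a \<in> amplitudes G k \<Longrightarrow> - a \<in> amplitudes G k"
  by (simp add: amplitudes_def formal_symbols_uminus)

lemma amplitudes_minus: "a \<in> amplitudes G k \<Longrightarrow> b \<in> amplitudes G k \<Longrightarrow> a - b \<in> amplitudes G k"
  using amplitudes_add[OF _ amplitudes_uminus, of a G k b] by simp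

lemma amplitudes_zero: "0 \<in> amplitudes G k"
  by (simp add: amplitudes_def formal_symbols_def Pol_zero)

lemma amplitudes_formal_symbols: "a \<in> amplitudes G k \<Longrightarrow> gs \<in> tuples G k \<Longrightarrow> a gs \<in> formal_symbols"
  by (simp add: amplitudes_def)

lemma hbar_times_amplitudes: "c \<in> Pol_cochains G n k \<Longrightarrow> hbar_times n c \<in> amplitudes G k"
  by (auto simp: Pol_cochains_def amplitudes_def hbar_times_def formal_symbols_def Pol_zero fun_eq_iff)

lemma diff_0: "diff G 0 a = 0"
  by (auto simp: diff_def fun_eq_iff)

lemma diff_1:
  assumes "g \<in> carrier G" "h \<in> carrier G"
  shows "diff G 1 a [g, h] = - a [g \<otimes>\<^bsub>G\<^esub> h]"
  using assms by (simp add: diff_def merge_def tuples_def fun_eq_iff)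

lemma diff_2:
  assumes "g \<in> carrier G" "h \<in> carrier G" "k \<in> carrier G"
  shows "diff G 2 c [g, h, k] = c [g, h \<otimes>\<^bsub>G\<^esub> k] - c [g \<otimes>\<^bsub>G\<^esub> h, k]"
proof -
  have "{1..2::nat} = {1, 2}" by auto
  then show ?thesis using assms by (simp add: diff_def merge_def tuples_def fun_eq_iff)
qed

section \<open>Amplitudes as families of operator series\<close>

locale smooth_group_action = group G for G (structure) +
  fixes \<phi> :: "'a \<Rightarrow> real^'d \<Rightarrow> real^('d::finite)"
  assumes action: "smooth_action G \<phi>"
begin

lemma diffeo_action: "g \<in> carrier G \<Longrightarrow> diffeo (\<phi> g)"
  and action_mult: "g \<in> carrier G \<Longrightarrow> h \<in> carrier G \<Longrightarrow> \<phi> (g \<otimes> h) = \<phi> g \<circ> \<phi> h"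
  and action_one: "\<phi> \<one> = id"
  using action by (auto simp: smooth_action_def)

lemma group_prod_closed: "set gs \<subseteq> carrier G \<Longrightarrow> group_prod G gs \<in> carrier G"
  unfolding group_prod_def by (induction gs) auto

lemma group_prod_append:
  "set gs \<subseteq> carrier G \<Longrightarrow> set hs \<subseteq> carrier G \<Longrightarrow>
    group_prod G (gs @ hs) = group_prod G gs \<otimes> group_prod G hs"
proof (induction gs)
  case Nil
  then show ?case using group_prod_closed[of hs] by (simp add: group_prod_def)
next
  case (Cons g gs)
  then show ?case using group_prod_closed[of hs] group_prod_closed[of gs]
    by (simp add: group_prod_def m_assoc)
qed

lemma group_prod_simps:
  "group_prod G [] = \<one>"
  "g \<in> carrier G \<Longrightarrow> group_prod G [g] = g"
  "g \<in> carrier G \<Longrightarrow> h \<in> carrier G \<Longrightarrow> group_prod G [g, h] = g \<otimes> h"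
  by (simp_all add: group_prod_def)

text \<open>The value at \<open>gs\<close> is quantised over the diffeomorphism of the product of
  all entries of \<open>gs\<close>. With this choice the diffeomorphisms of two factors compose to
  that of the concatenated tuple.\<close>

definition amp :: "('a, 'd) amplitude \<Rightarrow> 'a list \<Rightarrow> 'd smooth_op fps"
  where "amp a gs = symbol_series (\<phi> (group_prod G gs)) (a gs)"

lemma diffeo_tuple: "gs \<in> tuples G k \<Longrightarrow> diffeo (\<phi> (group_prod G gs))"
  using diffeo_action group_prod_closed by (simp add: tuples_def)

lemma amp_add:
  "a \<in> amplitudes G k \<Longrightarrow> b \<in> amplitudes G k \<Longrightarrow> gs \<in> tuples G k \<Longrightarrow>
    amp (a + b) gs = amp a gs + amp b gs"
  unfolding amp_def plus_fun_apply[of a b gs]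
  by (intro symbol_series_add diffeo_tuple amplitudes_formal_symbols)

lemma amp_uminus:
  "a \<in> amplitudes G k \<Longrightarrow> gs \<in> tuples G k \<Longrightarrow> amp (- a) gs = - amp a gs"
  unfolding amp_def uminus_apply[of a gs]
  by (intro symbol_series_uminus diffeo_tuple amplitudes_formal_symbols)

lemma amp_minus:
  "a \<in> amplitudes G k \<Longrightarrow> b \<in> amplitudes G k \<Longrightarrow> gs \<in> tuples G k \<Longrightarrow>
    amp (a - b) gs = amp a gs - amp b gs"
  using amp_add[OF _ amplitudes_uminus, of a k b gs] amp_uminus[of b k gs] by simp

lemma amp_zero: "gs \<in> tuples G k \<Longrightarrow> amp 0 gs = 0"
  unfolding amp_def zero_fun_apply[of gs] by (rule symbol_series_zero[OF diffeo_tuple])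

text \<open>Faithfulness lets every identity between amplitudes be checked in the ring of operator
  series; \<open>amp_surj\<close> brings solutions back.\<close>

lemma amp_eqI:
  assumes "a \<in> amplitudes G k" "b \<in> amplitudes G k"
    and "\<And>gs. gs \<in> tuples G k \<Longrightarrow> amp a gs = amp b gs"
  shows "a = b"
proof
  fix gs
  show "a gs = b gs"
  proof (cases "gs \<in> tuples G k")
    case True
    show ?thesis
      by (rule symbol_series_inject[OF diffeo_tuple[OF True]
            amplitudes_formal_symbols[OF assms(1) True] amplitudes_formal_symbols[OF assms(2) True]
            assms(3)[OF True, unfolded amp_def]])
  next
    case False
    then show ?thesis using assms(1,2) by (simp add: amplitudes_def)
  qed
qed

lemma amp_surj:
  assumes "\<And>gs n. gs \<in> tuples G k \<Longrightarrow> fps_nth (F gs) n \<in> ops n (\<phi> (group_prod G gs))"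
  shows "\<exists>a\<in>amplitudes G k. \<forall>gs\<in>tuples G k. amp a gs = F gs"
proof -
  have "\<exists>P. P \<in> formal_symbols \<and> symbol_series (\<phi> (group_prod G gs)) P = F gs"
    if "gs \<in> tuples G k" for gs
    using symbol_series_surj[of "F gs" "\<phi> (group_prod G gs)"] assms[OF that] by metis
  then obtain P where P: "\<And>gs. gs \<in> tuples G k \<Longrightarrow> P gs \<in> formal_symbols"
    "\<And>gs. gs \<in> tuples G k \<Longrightarrow> symbol_series (\<phi> (group_prod G gs)) (P gs) = F gs"
    by metis
  show ?thesis
    by (rule bexI[of _ "\<lambda>gs. if gs \<in> tuples G k then P gs else 0"])
      (auto simp: amplitudes_def amp_def P)
qed

lemma tuples_take_drop:
  assumes "gs \<in> tuples G (k + l)"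
  shows "take k gs \<in> tuples G k" "drop k gs \<in> tuples G l"
    and "\<phi> (group_prod G gs) = \<phi> (group_prod G (take k gs)) \<circ> \<phi> (group_prod G (drop k gs))"
proof -
  have *: "set (take k gs) \<subseteq> carrier G" "set (drop k gs) \<subseteq> carrier G"
    using assms set_take_subset[of k gs] set_drop_subset[of k gs] by (auto simp: tuples_def)
  show "take k gs \<in> tuples G k" "drop k gs \<in> tuples G l"
    using * assms by (auto simp: tuples_def)
  show "\<phi> (group_prod G gs) = \<phi> (group_prod G (take k gs)) \<circ> \<phi> (group_prod G (drop k gs))"
    using group_prod_append[OF *] action_mult[OF group_prod_closed group_prod_closed, OF *] by simp
qed

lemma
  assumes a: "a \<in> amplitudes G k" and b: "b \<in> amplitudes G l"
  shows star_amplitudes: "star G \<phi> k l a b \<in> amplitudes G (k + l)"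
    and amp_star: "gs \<in> tuples G (k + l) \<Longrightarrow>
      amp (star G \<phi> k l a b) gs = amp a (take k gs) * amp b (drop k gs)"
proof -
  have *: "star G \<phi> k l a b gs \<in> formal_symbols \<and>
      amp (star G \<phi> k l a b) gs = amp a (take k gs) * amp b (drop k gs)"
    if gs: "gs \<in> tuples G (k + l)" for gs
  proof -
    note t = tuples_take_drop[OF gs]
    note s = symbol_star[OF diffeo_tuple[OF t(1)] diffeo_tuple[OF t(2)] diffeo_tuple[OF gs, unfolded t(3)]
      amplitudes_formal_symbols[OF a t(1)] amplitudes_formal_symbols[OF b t(2)]]
    show ?thesis using s gs by (simp add: star_def amp_def t(3))
  qed
  show "star G \<phi> k l a b \<in> amplitudes G (k + l)"
    using * by (simp add: amplitudes_def star_def)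
  show "amp (star G \<phi> k l a b) gs = amp a (take k gs) * amp b (drop k gs)"
    if "gs \<in> tuples G (k + l)"
    using * that by blast
qed

lemma diff_1_amplitudes:
  assumes "a \<in> amplitudes G 1"
  shows "diff G 1 a \<in> amplitudes G 2"
proof -
  have "diff G 1 a gs \<in> formal_symbols" if gs: "gs \<in> tuples G 2" for gs
  proof -
    obtain g h where "g \<in> carrier G" "h \<in> carrier G" "gs = [g, h]" using gs by (auto simp: tuples_2)
    then show ?thesis
      using amplitudes_formal_symbols[OF assms, of "[g \<otimes> h]"]
      by (simp add: diff_1 formal_symbols_uminus tuples_1 del: One_nat_def)
  qed
  then show ?thesis by (auto simp: amplitudes_def diff_def numeral_2_eq_2)
qed

lemma amp_diff_1:
  assumes "a \<in> amplitudes G 1" "g \<in> carrier G" "h \<in> carrier G"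
  shows "amp (diff G 1 a) [g, h] = - amp a [g \<otimes> h]"
  using amp_uminus[OF assms(1), of "[g \<otimes> h]"] assms(2,3)
  by (simp add: amp_def diff_1 tuples_1 group_prod_simps del: One_nat_def)

lemma diff_2_amplitudes:
  assumes "c \<in> amplitudes G 2"
  shows "diff G 2 c \<in> amplitudes G 3"
proof -
  have "diff G 2 c gs \<in> formal_symbols" if gs: "gs \<in> tuples G 3" for gs
  proof -
    obtain g h k where *: "g \<in> carrier G" "h \<in> carrier G" "k \<in> carrier G" "gs = [g, h, k]"
      using gs by (auto simp: tuples_3)
    have "c [g, h \<otimes> k] + - c [g \<otimes> h, k] \<in> formal_symbols"
      using * by (intro formal_symbols_add formal_symbols_uminus amplitudes_formal_symbols[OF assms])
        (auto simp: tuples_2)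
    then show ?thesis using * by (simp add: diff_2)
  qed
  then show ?thesis by (auto simp: amplitudes_def diff_def numeral_3_eq_3 numeral_2_eq_2)
qed

lemma amp_diff_2:
  assumes "c \<in> amplitudes G 2" "g \<in> carrier G" "h \<in> carrier G" "k \<in> carrier G"
  shows "amp (diff G 2 c) [g, h, k] = amp c [g, h \<otimes> k] - amp c [g \<otimes> h, k]"
proof -
  have t: "[g, h \<otimes> k] \<in> tuples G 2" "[g \<otimes> h, k] \<in> tuples G 2" using assms by (auto simp: tuples_2)
  \<comment> \<open>By associativity all symbols involved are quantised over the same
    diffeomorphism, so their operators can be added.\<close>
  have p: "group_prod G [g, h, k] = g \<otimes> (h \<otimes> k)" "group_prod G [g, h \<otimes> k] = g \<otimes> (h \<otimes> k)"
    "group_prod G [g \<otimes> h, k] = g \<otimes> (h \<otimes> k)"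
    using assms(2-) by (simp_all add: group_prod_def m_assoc)
  have "symbol_series (\<phi> (g \<otimes> (h \<otimes> k))) (c [g, h \<otimes> k] + - c [g \<otimes> h, k]) =
    symbol_series (\<phi> (g \<otimes> (h \<otimes> k))) (c [g, h \<otimes> k]) + - symbol_series (\<phi> (g \<otimes> (h \<otimes> k))) (c [g \<otimes> h, k])"
    using assms(2-) amplitudes_formal_symbols[OF assms(1)] t
    by (simp add: symbol_series_add symbol_series_uminus formal_symbols_uminus diffeo_action
      del: add_uminus_conv_diff)
  then show ?thesis using assms(2-) by (simp add: amp_def diff_2 p)
qed

text \<open>In degree one \<open>diff\<close> contributes a single term, the value at the merged
  pair with sign -1, while \<open>star\<close> contributes the product of the operators.\<close>

lemma maurer_cartan_iff:
  "maurer_cartan G \<phi> a \<longleftrightarrow> a \<in> amplitudes G 1 \<and>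
    (\<forall>g\<in>carrier G. \<forall>h\<in>carrier G. amp a [g] * amp a [h] = amp a [g \<otimes> h])"
proof (cases "a \<in> amplitudes G 1")
  case a: True
  have star: "star G \<phi> 1 1 a a \<in> amplitudes G 2"
    using star_amplitudes[OF a a] by (simp add: numeral_2_eq_2)
  have amp: "amp (diff G 1 a + star G \<phi> 1 1 a a) [g, h] = amp a [g] * amp a [h] - amp a [g \<otimes> h]"
    if G: "g \<in> carrier G" "h \<in> carrier G" for g h
  proof -
    have "[g, h] \<in> tuples G 2" using G by (simp add: tuples_2)
    then show ?thesis
      using amp_add[OF diff_1_amplitudes[OF a] star, of "[g, h]"] amp_diff_1[OF a G]
        amp_star[OF a a, of "[g, h]"]
      by (simp add: numeral_2_eq_2)
  qed
  have "diff G 1 a + star G \<phi> 1 1 a a = 0 \<longleftrightarrow>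
    (\<forall>gs\<in>tuples G 2. amp (diff G 1 a + star G \<phi> 1 1 a a) gs = 0)"
    using amp_eqI[OF amplitudes_add[OF diff_1_amplitudes[OF a] star] amplitudes_zero] amp_zero
    by metis
  also have "\<dots> \<longleftrightarrow> (\<forall>g\<in>carrier G. \<forall>h\<in>carrier G. amp a [g] * amp a [h] = amp a [g \<otimes> h])"
    by (simp add: ball_tuples_2 amp del: One_nat_def)
  finally show ?thesis by (simp add: maurer_cartan_def a)
qed (simp add: maurer_cartan_def)

lemma amp_hbar_times_nth:
  assumes "gs \<in> tuples G k"
  shows "fps_nth (amp (hbar_times n c) gs) m = (if m = n then symbol_op n (\<phi> (group_prod G gs)) (c gs) else 0)"
  using diffeo_tuple[OF assms] by (simp add: amp_def hbar_times_def symbol_op_zero)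

end

section \<open>Cohomology and deformations of amplitudes\<close>

text \<open>The quotient is unfolded to cosets: if \<open>B\<close> is the only coset, the coset of
  \<open>z\<close> is \<open>B\<close>, and it contains \<open>0 + z\<close>.\<close>

lemma trivial_quotient_imp_subset:
  assumes "trivial_group (additive_group Z Mod B)" "0 \<in> B"
  shows "Z \<subseteq> B"
proof
  fix z assume z: "z \<in> Z"
  have "carrier (additive_group Z Mod B) = {B}"
    using assms(1) by (simp add: trivial_group_def FactGroup_def)
  then have "B #>\<^bsub>additive_group Z\<^esub> z = B"
    using z by (auto simp: FactGroup_def RCOSETS_def additive_group_def)
  moreover have "0 + z \<in> B #>\<^bsub>additive_group Z\<^esub> z"
    using assms(2) by (auto simp: r_coset_def additive_group_def)
  ultimately show "z \<in> B" by simp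
qed

lemma coboundaries_1: "coboundaries G \<phi> P0 n 1 = Pol_diff G \<phi> P0 n 0 ` Pol_cochains G n 0"
  by (simp add: coboundaries_def)

lemma coboundaries_2: "coboundaries G \<phi> P0 n 2 = Pol_diff G \<phi> P0 n 1 ` Pol_cochains G n 1"
  by (simp add: coboundaries_def numeral_2_eq_2)

locale maurer_cartan_base = smooth_group_action G \<phi>
  for G :: "('a, 'b) monoid_scheme" (structure)
    and \<phi> :: "'a \<Rightarrow> real^'d \<Rightarrow> real^('d::finite)" +
  fixes P0 :: "'a list \<Rightarrow> 'd symbol"
  assumes P0: "P0 \<in> Pol_cochains G 0 1"
    and MC0: "maurer_cartan G \<phi> (hbar_times 0 P0)"
begin

definition A0 :: "'a \<Rightarrow> 'd smooth_op"
  where "A0 g = symbol_op 0 (\<phi> g) (P0 [g])"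

lemma hbar_P0: "hbar_times 0 P0 \<in> amplitudes G 1"
  by (rule hbar_times_amplitudes[OF P0])

lemma amp_P0: "g \<in> carrier G \<Longrightarrow> amp (hbar_times 0 P0) [g] = fps_const (A0 g)"
  by (auto simp: fps_eq_iff amp_hbar_times_nth[of _ 1] tuples_1 group_prod_simps A0_def
    simp del: One_nat_def)

text \<open>Here the Maurer-Cartan equation of \<open>P0\<close> enters: it is the multiplicativity
  of \<open>A0\<close>. All deformation results of the abstract setting become available.\<close>

sublocale filtered_representation G "\<lambda>n g. ops n (\<phi> g)" A0
proof
  fix g h a b m n assume G: "g \<in> carrier G" "h \<in> carrier G"
  show "a * b \<in> ops (m + n) (\<phi> (g \<otimes> h))" if "a \<in> ops m (\<phi> g)" "b \<in> ops n (\<phi> h)"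
    using ops_mult[OF diffeo_action[OF G(1)] diffeo_action[OF G(2)] _ that]
      diffeo_action[of "g \<otimes> h"] action_mult[OF G] G by simp
  have "fps_const (A0 g) * fps_const (A0 h) = fps_const (A0 (g \<otimes> h))"
    using MC0 G by (simp add: maurer_cartan_iff amp_P0)
  then show "A0 g * A0 h = A0 (g \<otimes> h)" by simp
next
  fix g assume "g \<in> carrier G"
  then show "A0 g \<in> ops 0 (\<phi> g)"
    using P0 by (auto simp: A0_def ops_def Pol_cochains_def tuples_1 simp del: One_nat_def)
qed (simp_all add: ops_zero ops_add ops_uminus diffeo_action action_one ops_one)

section \<open>The twisted differential in terms of operators\<close>

lemma twisted_diff_eq:
  shows "twisted_diff G \<phi> P0 0 a = star G \<phi> 1 0 (hbar_times 0 P0) a - star G \<phi> 0 1 a (hbar_times 0 P0)"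
    and "twisted_diff G \<phi> P0 1 a =
      diff G 1 a + star G \<phi> 1 1 (hbar_times 0 P0) a + star G \<phi> 1 1 a (hbar_times 0 P0)"
    and "twisted_diff G \<phi> P0 2 a =
      diff G 2 a + star G \<phi> 1 2 (hbar_times 0 P0) a - star G \<phi> 2 1 a (hbar_times 0 P0)"
  by (simp_all add: twisted_diff_def fun_eq_iff diff_0)

lemma symbol_op_Pol_diff:
  "symbol_op n (\<phi> (group_prod G gs)) (Pol_diff G \<phi> P0 n k c gs) =
    fps_nth (amp (twisted_diff G \<phi> P0 k (hbar_times n c)) gs) n"
  by (simp add: Pol_diff_def amp_def)

lemma twisted_diff_0:
  assumes a: "a \<in> amplitudes G 0"
  shows "twisted_diff G \<phi> P0 0 a \<in> amplitudes G 1"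
    and "g \<in> carrier G \<Longrightarrow>
      amp (twisted_diff G \<phi> P0 0 a) [g] = fps_const (A0 g) * amp a [] - amp a [] * fps_const (A0 g)"
proof -
  note s = star_amplitudes[OF hbar_P0 a, simplified add_0_right] star_amplitudes[OF a hbar_P0, simplified add_0_left]
  show "twisted_diff G \<phi> P0 0 a \<in> amplitudes G 1"
    unfolding twisted_diff_eq by (intro amplitudes_minus s)
  assume "g \<in> carrier G"
  then show "amp (twisted_diff G \<phi> P0 0 a) [g] = fps_const (A0 g) * amp a [] - amp a [] * fps_const (A0 g)"
    unfolding twisted_diff_eq
    using amp_minus[OF s, of "[g]"] amp_star[OF hbar_P0 a, of "[g]"] amp_star[OF a hbar_P0, of "[g]"]
    by (simp add: tuples_1 amp_P0 del: One_nat_def)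
qed

lemma twisted_diff_1:
  assumes a: "a \<in> amplitudes G 1"
  shows "twisted_diff G \<phi> P0 1 a \<in> amplitudes G 2"
    and "g \<in> carrier G \<Longrightarrow> h \<in> carrier G \<Longrightarrow> amp (twisted_diff G \<phi> P0 1 a) [g, h] =
      fps_const (A0 g) * amp a [h] + amp a [g] * fps_const (A0 h) - amp a [g \<otimes> h]"
proof -
  note s = star_amplitudes[OF hbar_P0 a, unfolded one_add_one] star_amplitudes[OF a hbar_P0, unfolded one_add_one]
  note d = diff_1_amplitudes[OF a]
  note ds = amplitudes_add[OF d s(1)]
  show "twisted_diff G \<phi> P0 1 a \<in> amplitudes G 2"
    unfolding twisted_diff_eq by (rule amplitudes_add[OF ds s(2)])
  assume G: "g \<in> carrier G" "h \<in> carrier G"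
  then have t: "[g, h] \<in> tuples G 2" by (simp add: tuples_2)
  show "amp (twisted_diff G \<phi> P0 1 a) [g, h] =
      fps_const (A0 g) * amp a [h] + amp a [g] * fps_const (A0 h) - amp a [g \<otimes> h]"
    unfolding twisted_diff_eq
    using amp_add[OF ds s(2) t] amp_add[OF d s(1) t] amp_diff_1[OF a G]
      amp_star[OF hbar_P0 a, unfolded one_add_one, OF t] amp_star[OF a hbar_P0, unfolded one_add_one, OF t] G
    by (simp add: amp_P0)
qed

lemma twisted_diff_2:
  assumes a: "a \<in> amplitudes G 2"
  shows "twisted_diff G \<phi> P0 2 a \<in> amplitudes G 3"
    and "g \<in> carrier G \<Longrightarrow> h \<in> carrier G \<Longrightarrow> k \<in> carrier G \<Longrightarrow>
      amp (twisted_diff G \<phi> P0 2 a) [g, h, k] = fps_const (A0 g) * amp a [h, k] - amp a [g \<otimes> h, k]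
        + amp a [g, h \<otimes> k] - amp a [g, h] * fps_const (A0 k)"
proof -
  have three: "1 + 2 = (3::nat)" "2 + 1 = (3::nat)" by simp_all
  note s = star_amplitudes[OF hbar_P0 a, unfolded three] star_amplitudes[OF a hbar_P0, unfolded three]
  note d = diff_2_amplitudes[OF a]
  note ds = amplitudes_add[OF d s(1)]
  show "twisted_diff G \<phi> P0 2 a \<in> amplitudes G 3"
    unfolding twisted_diff_eq by (rule amplitudes_minus[OF ds s(2)])
  assume G: "g \<in> carrier G" "h \<in> carrier G" "k \<in> carrier G"
  then have t: "[g, h, k] \<in> tuples G 3" by (simp add: tuples_3)
  show "amp (twisted_diff G \<phi> P0 2 a) [g, h, k] = fps_const (A0 g) * amp a [h, k] - amp a [g \<otimes> h, k]
        + amp a [g, h \<otimes> k] - amp a [g, h] * fps_const (A0 k)"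
    unfolding twisted_diff_eq
    using amp_minus[OF ds s(2) t] amp_add[OF d s(1) t] amp_diff_2[OF a G]
      amp_star[OF hbar_P0 a, unfolded three, OF t] amp_star[OF a hbar_P0, unfolded three, OF t] G
    by (simp add: amp_P0)
qed

section \<open>Cochains of symbols against families of operators\<close>

lemma Pol_diff_cochain:
  assumes "twisted_diff G \<phi> P0 k (hbar_times n c) \<in> amplitudes G l"
  shows "Pol_diff G \<phi> P0 n k c \<in> Pol_cochains G n l"
  using assms by (auto simp: Pol_cochains_def Pol_diff_def amplitudes_def formal_symbols_def)

lemma symbol_op_cochain_inject:
  assumes "c \<in> Pol_cochains G n k" "c' \<in> Pol_cochains G n k"
    and "\<And>gs. gs \<in> tuples G k \<Longrightarrow>
      symbol_op n (\<phi> (group_prod G gs)) (c gs) = symbol_op n (\<phi> (group_prod G gs)) (c' gs)"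
  shows "c = c'"
proof
  fix gs show "c gs = c' gs"
  proof (cases "gs \<in> tuples G k")
    case True
    then have "c gs \<in> Pol n" "c' gs \<in> Pol n" using assms(1,2) by (simp_all add: Pol_cochains_def)
    then show ?thesis by (rule symbol_op_inject[OF diffeo_tuple[OF True] _ _ assms(3)[OF True]])
  next
    case False
    then show ?thesis using assms(1,2) by (simp add: Pol_cochains_def)
  qed
qed

lemma symbol_op_cochain_surj:
  assumes "\<And>gs. gs \<in> tuples G k \<Longrightarrow> f gs \<in> ops n (\<phi> (group_prod G gs))"
  shows "\<exists>c\<in>Pol_cochains G n k. \<forall>gs\<in>tuples G k. symbol_op n (\<phi> (group_prod G gs)) (c gs) = f gs"
proof -
  have "\<exists>P. P \<in> Pol n \<and> symbol_op n (\<phi> (group_prod G gs)) P = f gs" if "gs \<in> tuples G k" for gs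
    using assms[OF that] unfolding ops_def by auto
  then obtain P where P: "\<And>gs. gs \<in> tuples G k \<Longrightarrow> P gs \<in> Pol n"
    "\<And>gs. gs \<in> tuples G k \<Longrightarrow> symbol_op n (\<phi> (group_prod G gs)) (P gs) = f gs"
    by metis
  show ?thesis
    by (rule bexI[of _ "\<lambda>gs. if gs \<in> tuples G k then P gs else 0"]) (auto simp: Pol_cochains_def P)
qed

lemma zero_cochain: "0 \<in> Pol_cochains G n k"
  by (simp add: Pol_cochains_def Pol_zero)

text \<open>The instance of \<open>zero_fun_apply\<close> at the type of cochains, which as a
  rewrite rule leaves zeros of other function types alone.\<close>

lemma zero_cochain_apply: "(0 :: 'a list \<Rightarrow> 'd symbol) gs = 0"
  by (rule zero_fun_apply)

lemma cochain_eq_0_iff: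
  assumes c: "c \<in> Pol_cochains G n k"
  shows "c = 0 \<longleftrightarrow> (\<forall>gs\<in>tuples G k. symbol_op n (\<phi> (group_prod G gs)) (c gs) = 0)"
proof
  assume "c = 0"
  then show "\<forall>gs\<in>tuples G k. symbol_op n (\<phi> (group_prod G gs)) (c gs) = 0"
    using symbol_op_zero[OF diffeo_tuple] by (simp only: zero_cochain_apply) blast
next
  assume "\<forall>gs\<in>tuples G k. symbol_op n (\<phi> (group_prod G gs)) (c gs) = 0"
  then show "c = 0"
    by (intro symbol_op_cochain_inject[OF c zero_cochain])
      (simp only: zero_cochain_apply symbol_op_zero[OF diffeo_tuple])
qed

lemma
  assumes c: "c \<in> Pol_cochains G n 0"
  shows Pol_diff_0_cochain: "Pol_diff G \<phi> P0 n 0 c \<in> Pol_cochains G n 1"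
    and symbol_op_Pol_diff_0: "g \<in> carrier G \<Longrightarrow> symbol_op n (\<phi> g) (Pol_diff G \<phi> P0 n 0 c [g]) =
      A0 g * symbol_op n id (c []) - symbol_op n id (c []) * A0 g"
  using Pol_diff_cochain[OF twisted_diff_0(1)[OF hbar_times_amplitudes[OF c]]]
    symbol_op_Pol_diff[of n "[g]" 0 c] twisted_diff_0(2)[OF hbar_times_amplitudes[OF c], of g]
    amp_hbar_times_nth[of "[]" 0 n c n]
  by (auto simp: group_prod_simps tuples_0 action_one)

lemma
  assumes c: "c \<in> Pol_cochains G n 1"
  shows Pol_diff_1_cochain: "Pol_diff G \<phi> P0 n 1 c \<in> Pol_cochains G n 2"
    and symbol_op_Pol_diff_1: "g \<in> carrier G \<Longrightarrow> h \<in> carrier G \<Longrightarrow>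
      symbol_op n (\<phi> (g \<otimes> h)) (Pol_diff G \<phi> P0 n 1 c [g, h]) =
        coboundary1 (\<lambda>g. symbol_op n (\<phi> g) (c [g])) g h"
proof -
  show "Pol_diff G \<phi> P0 n 1 c \<in> Pol_cochains G n 2"
    by (rule Pol_diff_cochain[OF twisted_diff_1(1)[OF hbar_times_amplitudes[OF c]]])
  assume G: "g \<in> carrier G" "h \<in> carrier G"
  have nth: "fps_nth (amp (hbar_times n c) [k]) n = symbol_op n (\<phi> k) (c [k])" if "k \<in> carrier G" for k
    using amp_hbar_times_nth[of "[k]" 1 n c n] that by (simp add: tuples_1 group_prod_simps del: One_nat_def)
  show "symbol_op n (\<phi> (g \<otimes> h)) (Pol_diff G \<phi> P0 n 1 c [g, h]) =
        coboundary1 (\<lambda>g. symbol_op n (\<phi> g) (c [g])) g h"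
    using symbol_op_Pol_diff[of n "[g, h]" 1 c] twisted_diff_1(2)[OF hbar_times_amplitudes[OF c] G] G
    by (simp add: group_prod_simps coboundary1_def nth del: One_nat_def)
qed

lemma
  assumes c: "c \<in> Pol_cochains G n 2"
  shows Pol_diff_2_cochain: "Pol_diff G \<phi> P0 n 2 c \<in> Pol_cochains G n 3"
    and symbol_op_Pol_diff_2: "g \<in> carrier G \<Longrightarrow> h \<in> carrier G \<Longrightarrow> k \<in> carrier G \<Longrightarrow>
      symbol_op n (\<phi> (group_prod G [g, h, k])) (Pol_diff G \<phi> P0 n 2 c [g, h, k]) =
        coboundary2 (\<lambda>g h. symbol_op n (\<phi> (g \<otimes> h)) (c [g, h])) g h k"
proof -
  show "Pol_diff G \<phi> P0 n 2 c \<in> Pol_cochains G n 3"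
    by (rule Pol_diff_cochain[OF twisted_diff_2(1)[OF hbar_times_amplitudes[OF c]]])
  assume G: "g \<in> carrier G" "h \<in> carrier G" "k \<in> carrier G"
  have nth: "fps_nth (amp (hbar_times n c) [g, h]) n = symbol_op n (\<phi> (g \<otimes> h)) (c [g, h])"
    if "g \<in> carrier G" "h \<in> carrier G" for g h
    using amp_hbar_times_nth[of "[g, h]" 2 n c n] that by (simp add: tuples_2 group_prod_simps)
  show "symbol_op n (\<phi> (group_prod G [g, h, k])) (Pol_diff G \<phi> P0 n 2 c [g, h, k]) =
        coboundary2 (\<lambda>g h. symbol_op n (\<phi> (g \<otimes> h)) (c [g, h])) g h k"
    using symbol_op_Pol_diff[of n "[g, h, k]" 2 c] twisted_diff_2(2)[OF hbar_times_amplitudes[OF c] G] G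
    by (simp add: coboundary2_def nth)
qed

text \<open>Places 0 among the coboundaries, as \<open>trivial_quotient_imp_subset\<close> requires;
  \<open>Pol_diff_1_zero\<close> does the same one degree higher.\<close>

lemma Pol_diff_0_zero: "Pol_diff G \<phi> P0 n 0 0 = 0"
  unfolding cochain_eq_0_iff[OF Pol_diff_0_cochain[OF zero_cochain]]
  by (auto simp: tuples_1 group_prod_simps symbol_op_Pol_diff_0[OF zero_cochain] zero_cochain_apply
      symbol_op_zero diffeo_id simp del: One_nat_def zero_fun_apply)

lemma Pol_diff_1_zero: "Pol_diff G \<phi> P0 n 1 0 = 0"
  unfolding cochain_eq_0_iff[OF Pol_diff_1_cochain[OF zero_cochain]]
  by (auto simp: tuples_2 group_prod_simps symbol_op_Pol_diff_1[OF zero_cochain] zero_cochain_apply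
      symbol_op_zero diffeo_action coboundary1_def simp del: One_nat_def zero_fun_apply)

lemma cocycles_1_iff:
  assumes "c \<in> Pol_cochains G n 1"
  shows "c \<in> cocycles G \<phi> P0 n 1 \<longleftrightarrow>
    (\<forall>g\<in>carrier G. \<forall>h\<in>carrier G. coboundary1 (\<lambda>g. symbol_op n (\<phi> g) (c [g])) g h = 0)"
proof -
  have "c \<in> cocycles G \<phi> P0 n 1 \<longleftrightarrow> Pol_diff G \<phi> P0 n 1 c = 0"
    using assms by (simp add: cocycles_def)
  also have "\<dots> \<longleftrightarrow> (\<forall>gs\<in>tuples G 2. symbol_op n (\<phi> (group_prod G gs)) (Pol_diff G \<phi> P0 n 1 c gs) = 0)"
    by (rule cochain_eq_0_iff[OF Pol_diff_1_cochain[OF assms]])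
  finally show ?thesis
    by (simp add: ball_tuples_2 group_prod_simps symbol_op_Pol_diff_1[OF assms] del: One_nat_def)
qed

text \<open>A family of operators is lifted to a cochain of symbols, the cohomology hypothesis
  supplies a primitive there, and the primitive is turned back into an operator.\<close>

lemma H1_vanishes_if_trivial:
  assumes "trivial_group (cohomology G \<phi> P0 n 1)"
  shows "H1_vanishes n"
  unfolding H1_vanishes_def
proof (intro allI impI)
  fix f assume f: "\<forall>g\<in>carrier G. f g \<in> ops n (\<phi> g)"
    and cocycle: "\<forall>g\<in>carrier G. \<forall>h\<in>carrier G. coboundary1 f g h = 0"
  \<comment> \<open>\<open>hd\<close> converts a family indexed by group elements into one indexed
    by tuples of length one.\<close>
  have "f (hd gs) \<in> ops n (\<phi> (group_prod G gs))" if "gs \<in> tuples G 1" for gs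
    using f that by (auto simp: tuples_1 group_prod_simps simp del: One_nat_def)
  then obtain c where c: "c \<in> Pol_cochains G n 1"
    "\<forall>gs\<in>tuples G 1. symbol_op n (\<phi> (group_prod G gs)) (c gs) = f (hd gs)"
    using symbol_op_cochain_surj[of 1 "\<lambda>gs. f (hd gs)" n] by blast
  have c1: "symbol_op n (\<phi> g) (c [g]) = f g" if "g \<in> carrier G" for g
    using c(2)[THEN bspec, of "[g]"] that by (simp add: tuples_1 group_prod_simps del: One_nat_def)
  have "c \<in> cocycles G \<phi> P0 n 1"
    using cocycle by (simp add: cocycles_1_iff[OF c(1)] coboundary1_def c1 del: One_nat_def)
  moreover have "cocycles G \<phi> P0 n 1 \<subseteq> coboundaries G \<phi> P0 n 1"
    using assms unfolding cohomology_def coboundaries_1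
    by (rule trivial_quotient_imp_subset) (rule image_eqI, rule Pol_diff_0_zero[symmetric], rule zero_cochain)
  ultimately obtain b where b: "b \<in> Pol_cochains G n 0" "c = Pol_diff G \<phi> P0 n 0 b"
    by (auto simp: coboundaries_1 simp del: One_nat_def)
  have "b [] \<in> Pol n" using b(1) by (simp add: Pol_cochains_def tuples_0)
  then have "symbol_op n id (b []) \<in> ops n (\<phi> \<one>)" by (simp add: action_one ops_def)
  moreover have "f g = A0 g * symbol_op n id (b []) - symbol_op n id (b []) * A0 g"
    if "g \<in> carrier G" for g
    using symbol_op_Pol_diff_0[OF b(1) that] c1[OF that] b(2) by simp
  ultimately show "\<exists>b\<in>ops n (\<phi> \<one>). \<forall>g\<in>carrier G. f g = A0 g * b - b * A0 g" by blast
qed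

lemma H2_vanishes_if_trivial:
  assumes "trivial_group (cohomology G \<phi> P0 n 2)"
  shows "H2_vanishes n"
  unfolding H2_vanishes_def
proof (intro allI impI)
  fix f assume f: "\<forall>g\<in>carrier G. \<forall>h\<in>carrier G. f g h \<in> ops n (\<phi> (g \<otimes> h))"
    and cocycle: "\<forall>g\<in>carrier G. \<forall>h\<in>carrier G. \<forall>k\<in>carrier G. coboundary2 f g h k = 0"
  \<comment> \<open>The pair of group elements is read off from a tuple of length two.\<close>
  have "f (hd gs) (hd (tl gs)) \<in> ops n (\<phi> (group_prod G gs))" if "gs \<in> tuples G 2" for gs
    using f that by (auto simp: tuples_2 group_prod_simps)
  then obtain c where c: "c \<in> Pol_cochains G n 2"
    "\<forall>gs\<in>tuples G 2. symbol_op n (\<phi> (group_prod G gs)) (c gs) = f (hd gs) (hd (tl gs))"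
    using symbol_op_cochain_surj[of 2 "\<lambda>gs. f (hd gs) (hd (tl gs))" n] by blast
  have c2: "symbol_op n (\<phi> (g \<otimes> h)) (c [g, h]) = f g h" if "g \<in> carrier G" "h \<in> carrier G" for g h
    using c(2)[THEN bspec, of "[g, h]"] that by (simp add: tuples_2 group_prod_simps)
  have "Pol_diff G \<phi> P0 n 2 c = 0"
    unfolding cochain_eq_0_iff[OF Pol_diff_2_cochain[OF c(1)]]
  proof
    fix gs assume gs: "gs \<in> tuples G 3"
    then obtain g h k where G: "g \<in> carrier G" "h \<in> carrier G" "k \<in> carrier G" "gs = [g, h, k]"
      by (auto simp: tuples_3)
    have "coboundary2 (\<lambda>g h. symbol_op n (\<phi> (g \<otimes> h)) (c [g, h])) g h k = coboundary2 f g h k"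
      using G(1-3) by (simp add: coboundary2_def c2)
    then show "symbol_op n (\<phi> (group_prod G gs)) (Pol_diff G \<phi> P0 n 2 c gs) = 0"
      using cocycle G(1-3) unfolding G(4) symbol_op_Pol_diff_2[OF c(1) G(1-3)] by (simp only:)
  qed
  then have "c \<in> cocycles G \<phi> P0 n 2" using c(1) by (simp add: cocycles_def)
  moreover have "cocycles G \<phi> P0 n 2 \<subseteq> coboundaries G \<phi> P0 n 2"
    using assms unfolding cohomology_def coboundaries_2
    by (rule trivial_quotient_imp_subset) (rule image_eqI, rule Pol_diff_1_zero[symmetric], rule zero_cochain)
  ultimately obtain b where b: "b \<in> Pol_cochains G n 1" "c = Pol_diff G \<phi> P0 n 1 b"
    by (auto simp: coboundaries_2 simp del: One_nat_def)
  let ?b = "\<lambda>g. symbol_op n (\<phi> g) (b [g])"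
  have "?b g \<in> ops n (\<phi> g)" if "g \<in> carrier G" for g
    using b(1) that by (auto simp: ops_def Pol_cochains_def tuples_1 simp del: One_nat_def)
  moreover have "f g h = coboundary1 ?b g h" if "g \<in> carrier G" "h \<in> carrier G" for g h
    unfolding symbol_op_Pol_diff_1[OF b(1) that, symmetric] b(2)[symmetric] by (rule c2[OF that, symmetric])
  ultimately show "\<exists>b. (\<forall>g\<in>carrier G. b g \<in> ops n (\<phi> g)) \<and>
      (\<forall>g\<in>carrier G. \<forall>h\<in>carrier G. f g h = coboundary1 b g h)"
    by (intro exI[of _ ?b] conjI ballI)
qed

section \<open>Transfer of the abstract results to amplitudes\<close>

lemma amp_nth_in_ops:
  assumes "a \<in> amplitudes G k" "gs \<in> tuples G k"
  shows "fps_nth (amp a gs) n \<in> ops n (\<phi> (group_prod G gs))"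
  using amplitudes_formal_symbols[OF assms] by (simp add: amp_def ops_def formal_symbols_def)

lemma deformation_exists:
  assumes P1: "P1 \<in> cocycles G \<phi> P0 1 1"
    and "\<And>n. n \<ge> 2 \<Longrightarrow> trivial_group (cohomology G \<phi> P0 n 2)"
  shows "\<exists>\<omega>. maurer_cartan G \<phi> \<omega> \<and>
    (\<exists>R\<in>O_hbar G 1 2. \<omega> = hbar_times 0 P0 + hbar_times 1 P1 + R)"
proof -
  have c: "P1 \<in> Pol_cochains G 1 1" using P1 by (simp add: cocycles_def)
  define A1 where "A1 = (\<lambda>g. symbol_op 1 (\<phi> g) (P1 [g]))"
  have "A1 g \<in> ops 1 (\<phi> g)" if "g \<in> carrier G" for g
    using c that by (auto simp: A1_def ops_def Pol_cochains_def tuples_1 simp del: One_nat_def)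
  moreover have "coboundary1 A1 g h = 0" if "g \<in> carrier G" "h \<in> carrier G" for g h
    using P1[unfolded cocycles_1_iff[OF c]] that by (simp only: A1_def)
  ultimately have "\<exists>A. (\<forall>g\<in>carrier G. (\<forall>n. fps_nth (A g) n \<in> ops n (\<phi> g)) \<and>
      fps_nth (A g) 0 = A0 g \<and> fps_nth (A g) 1 = A1 g) \<and>
    (\<forall>g\<in>carrier G. \<forall>h\<in>carrier G. A g * A h = A (g \<otimes> h))"
    by (intro solution_exists H2_vanishes_if_trivial assms(2))
  then obtain A where A: "\<And>g n. g \<in> carrier G \<Longrightarrow> fps_nth (A g) n \<in> ops n (\<phi> g)"
    "\<And>g. g \<in> carrier G \<Longrightarrow> fps_nth (A g) 0 = A0 g" "\<And>g. g \<in> carrier G \<Longrightarrow> fps_nth (A g) 1 = A1 g"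
    "\<And>g h. g \<in> carrier G \<Longrightarrow> h \<in> carrier G \<Longrightarrow> A g * A h = A (g \<otimes> h)"
    by blast
  have "fps_nth (A (hd gs)) n \<in> ops n (\<phi> (group_prod G gs))" if "gs \<in> tuples G 1" for gs n
    using that A(1) by (auto simp: tuples_1 group_prod_simps simp del: One_nat_def)
  then obtain \<omega> where \<omega>: "\<omega> \<in> amplitudes G 1" "\<forall>gs\<in>tuples G 1. amp \<omega> gs = A (hd gs)"
    using amp_surj[of 1 "\<lambda>gs. A (hd gs)"] by blast
  have \<omega>A: "amp \<omega> [g] = A g" if "g \<in> carrier G" for g
    using \<omega>(2)[THEN bspec, of "[g]"] that by (simp add: tuples_1 del: One_nat_def)
  have "maurer_cartan G \<phi> \<omega>" by (simp add: maurer_cartan_iff \<omega>(1) \<omega>A A(4) del: One_nat_def)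
  moreover define R where "R = \<omega> - (hbar_times 0 P0 + hbar_times 1 P1)"
  have R: "R \<in> amplitudes G 1" unfolding R_def
    by (intro amplitudes_minus amplitudes_add \<omega>(1) hbar_P0 hbar_times_amplitudes[OF c])
  \<comment> \<open>The orders 0 and 1 of \<omega> are known only as operators \<open>A0\<close> and
    \<open>A1\<close>; injectivity of \<open>symbol_op\<close> turns this into vanishing of the
    symbols of \<open>R\<close>.\<close>
  have "R gs n = 0" if "n < 2" for gs n
  proof (cases "gs \<in> tuples G 1")
    case True
    then obtain g where g: "g \<in> carrier G" "gs = [g]" by (auto simp: tuples_1 simp del: One_nat_def)
    have "amp R gs = A g - (amp (hbar_times 0 P0) gs + amp (hbar_times 1 P1) gs)"
      unfolding R_def amp_minus[OF \<omega>(1) amplitudes_add[OF hbar_P0 hbar_times_amplitudes[OF c]] True]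
        amp_add[OF hbar_P0 hbar_times_amplitudes[OF c] True]
      using \<omega>A[OF g(1)] g(2) by simp
    moreover have "n = 0 \<or> n = 1" using that by auto
    ultimately have "fps_nth (amp R gs) n = 0"
      using amp_hbar_times_nth[OF True] A(2,3)[OF g(1)] g
      by (auto simp: group_prod_simps A0_def A1_def simp del: One_nat_def)
    then have "symbol_op n (\<phi> g) (R gs n) = symbol_op n (\<phi> g) 0"
      using g by (simp add: amp_def group_prod_simps symbol_op_zero diffeo_action)
    moreover have "R gs n \<in> Pol n"
      using amplitudes_formal_symbols[OF R True] by (simp add: formal_symbols_def)
    ultimately show ?thesis
      using symbol_op_inject[OF diffeo_action[OF g(1)] _ Pol_zero] by blast
  next
    case False
    then show ?thesis using R by (simp add: amplitudes_def)
  qed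
  then have "R \<in> O_hbar G 1 2" using R by (simp add: O_hbar_def)
  moreover have "\<omega> = hbar_times 0 P0 + hbar_times 1 P1 + R" by (simp add: R_def)
  ultimately show ?thesis by blast
qed

lemma amp_unit: "amp unit_amplitude [] = 1"
proof (rule fps_ext)
  fix n show "fps_nth (amp unit_amplitude []) n = fps_nth 1 n"
    using amp_hbar_times_nth[of "[]" 0 0 "\<lambda>gs. if gs = [] then (\<lambda>x \<xi>. 1) else 0" n]
    by (simp add: unit_amplitude_def tuples_0 group_prod_simps action_one symbol_op_one)
qed

lemma unit_amplitude: "unit_amplitude \<in> amplitudes G 0"
  unfolding unit_amplitude_def
  by (rule hbar_times_amplitudes) (simp add: Pol_cochains_def tuples_0 Pol_one)

lemma degree_0_eqI:
  "a \<in> amplitudes G 0 \<Longrightarrow> b \<in> amplitudes G 0 \<Longrightarrow> amp a [] = amp b [] \<Longrightarrow> a = b"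
  by (rule amp_eqI) (auto simp: tuples_0)

lemma degree_0_star:
  assumes "a \<in> amplitudes G 0" "b \<in> amplitudes G 0"
  shows "star G \<phi> 0 0 a b \<in> amplitudes G 0" "amp (star G \<phi> 0 0 a b) [] = amp a [] * amp b []"
  using star_amplitudes[OF assms] amp_star[OF assms, of "[]"] by (simp_all add: tuples_0)

lemma degree_0_surj:
  assumes "\<And>n. fps_nth U n \<in> ops n (\<phi> \<one>)"
  obtains u where "u \<in> amplitudes G 0" "amp u [] = U"
proof -
  have "\<exists>u\<in>amplitudes G 0. \<forall>gs\<in>tuples G 0. amp u gs = U"
    by (rule amp_surj) (simp add: tuples_0 group_prod_simps assms)
  then show ?thesis using that by (auto simp: tuples_0)
qed

lemma rigid_if_trivial:
  assumes "\<And>n. n \<ge> 1 \<Longrightarrow> trivial_group (cohomology G \<phi> P0 n 1)"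
  shows "rigid G \<phi> P0"
  unfolding rigid_def
proof (intro conjI allI impI P0 MC0)
  fix a assume "maurer_cartan G \<phi> a \<and> (\<exists>Q\<in>O_hbar G 1 1. a = hbar_times 0 P0 + Q)"
  then obtain Q where a: "a \<in> amplitudes G 1"
    and mult: "\<And>g h. g \<in> carrier G \<Longrightarrow> h \<in> carrier G \<Longrightarrow> amp a [g] * amp a [h] = amp a [g \<otimes> h]"
    and Q: "Q \<in> O_hbar G 1 1" "a = hbar_times 0 P0 + Q"
    by (auto simp: maurer_cartan_iff simp del: One_nat_def)
  have t: "[g] \<in> tuples G 1" if "g \<in> carrier G" for g using that by (simp add: tuples_1 del: One_nat_def)
  have "fps_nth (amp a [g]) n \<in> ops n (\<phi> g)" if "g \<in> carrier G" for g n
    using amp_nth_in_ops[OF a t[OF that]] that by (simp add: group_prod_simps)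
  \<comment> \<open>\<open>Q\<close> starts in order 1, so order 0 of \<open>a\<close> is
    \<open>P0\<close>.\<close>
  moreover have "fps_nth (amp a [g]) 0 = A0 g" if "g \<in> carrier G" for g
    using Q that by (simp add: amp_def O_hbar_def hbar_times_def A0_def group_prod_simps)
  ultimately obtain U where U: "\<And>n. fps_nth U n \<in> ops n (\<phi> \<one>)" "fps_nth U 0 = 1"
    "\<And>g. g \<in> carrier G \<Longrightarrow> amp a [g] * U = U * fps_const (A0 g)"
    using gauge_exists[of "\<lambda>g. amp a [g]"] H1_vanishes_if_trivial[OF assms] mult by blast
  obtain V where V: "\<And>n. fps_nth V n \<in> ops n (\<phi> \<one>)" "U * V = 1" "V * U = 1"
    using inverse_exists[OF U(1,2)] by blast
  obtain u where u: "u \<in> amplitudes G 0" "amp u [] = U" using U(1) by (rule degree_0_surj)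
  obtain v where v: "v \<in> amplitudes G 0" "amp v [] = V" using V(1) by (rule degree_0_surj)
  have "invertible_amplitude G \<phi> u"
    unfolding invertible_amplitude_def
    by (intro conjI bexI[of _ v] u v degree_0_eqI degree_0_star unit_amplitude)
      (simp_all add: degree_0_star u v V amp_unit)
  \<comment> \<open>In degree 0 the differential is zero, so the gauge equation is precisely the
    intertwining relation satisfied by \<open>U\<close>.\<close>
  moreover have "star G \<phi> 1 0 a u - star G \<phi> 0 1 u (hbar_times 0 P0) = diff G 0 u"
    unfolding diff_0
  proof (rule amp_eqI[where k = 1])
    note s = star_amplitudes[OF a u(1), simplified add_0_right]
      star_amplitudes[OF u(1) hbar_P0, simplified add_0_left]
    show "star G \<phi> 1 0 a u - star G \<phi> 0 1 u (hbar_times 0 P0) \<in> amplitudes G 1"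
      by (intro amplitudes_minus s)
    fix gs assume gs: "gs \<in> tuples G 1"
    then obtain g where g: "g \<in> carrier G" "gs = [g]" by (auto simp: tuples_1 simp del: One_nat_def)
    show "amp (star G \<phi> 1 0 a u - star G \<phi> 0 1 u (hbar_times 0 P0)) gs = amp 0 gs"
      using amp_minus[OF s gs] amp_star[OF a u(1), of gs] amp_star[OF u(1) hbar_P0, of gs] gs
        amp_zero[OF gs] U(3)[OF g(1)] u(2) g amp_P0[OF g(1)]
      by simp
  qed (rule amplitudes_zero)
  ultimately show "gauge_equivalent G \<phi> a (hbar_times 0 P0)"
    unfolding gauge_equivalent_def by blast
qed

end

theorem theorem26:
  fixes G :: "('g, 'm) monoid_scheme"
    and \<phi> :: "'g \<Rightarrow> real^'d \<Rightarrow> real^('d::finite)"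
    and P0 P1 :: "'g list \<Rightarrow> 'd symbol"
  assumes "group G"
    and "smooth_action G \<phi>"
    and "P0 \<in> Pol_cochains G 0 1"
    and "maurer_cartan G \<phi> (hbar_times 0 P0)"
    and "P1 \<in> cocycles G \<phi> P0 1 1"
  shows "((\<forall>n\<ge>2. trivial_group (cohomology G \<phi> P0 n 2)) \<longrightarrow>
           (\<exists>\<omega>. maurer_cartan G \<phi> \<omega> \<and>
              (\<exists>R\<in>O_hbar G 1 2. \<omega> = hbar_times 0 P0 + hbar_times 1 P1 + R))) \<and>
         ((\<forall>n\<ge>1. trivial_group (cohomology G \<phi> P0 n 1)) \<longrightarrow> rigid G \<phi> P0)"
proof -
  interpret maurer_cartan_base G \<phi> P0
    using assms by (simp add: maurer_cartan_base_def maurer_cartan_base_axioms_def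
        smooth_group_action_def smooth_group_action_axioms_def)
  show ?thesis
    using deformation_exists[OF assms(5)] rigid_if_trivial by blast
qed

end
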